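(* In the multi-task in-context regression setting described in the context (noiseless labels), let $\mathbf{W}^\star_{\mathrm{PGD}}$ be a minimizer over $\mathbf{W}\in\mathbb{R}^{d\times d}$ of \[ \mathcal{L}(\tilde f_{\mathrm{PGD}})=\sum_{k=1}^K\pi_k\,\mathbb{E}_{\mathcal{D}_k}\big[(\mathbf{x}^\top\mathbf{W}\mathbf{X}^\top(\mathbf{y}-\mathbf{X}\boldsymbol{\mu}_k)+\mathbf{x}^\top\boldsymbol{\mu}_k-y)^2\big], \] let $\tilde{\mathcal{L}}^\star_{\mathrm{PGD}}$ be the minimal value, and $\bar{\mathbf{W}}^\star_{\mathrm{PGD}}=\boldsymbol{\Sigma}_x\mathbf{W}^\star_{\mathrm{PGD}}$. Then \[ \bar{\mathbf{W}}^\star_{\mathrm{PGD}}=\bar{\boldsymbol{\Sigma}}_\beta\left((n+1)\bar{\boldsymbol{\Sigma}}_\beta+\mathrm{tr}(\bar{\boldsymbol{\Sigma}}_\beta)\mathbf{I}\right)^{-1},\qquad \tilde{\mathcal{L}}^\star_{\mathrm{PGD}}=\mathrm{tr}(\bar{\boldsymbol{\Sigma}}_\beta)-n\,\mathrm{tr}\!\left(\bar{\mathbf{W}}^\star_{\mathrm{PGD}}\bar{\boldsymbol{\Sigma}}_\beta\right). \]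
   Context: Fix integers $n,d,K\ge 1$, $\boldsymbol{\Sigma}_x\succ 0$ in $\mathbb{R}^{d\times d}$, and for each task $k\in[K]$ a mean $\boldsymbol{\mu}_k\in\mathbb{R}^d$, a covariance $\boldsymbol{\Sigma}_{\beta_k}\succ0$, and $\pi_k\ge0$ with $\sum_k\pi_k=1$. Task $k$ distribution $\mathcal{D}_k$: $\boldsymbol{\beta}\sim\mathcal{N}(\boldsymbol{\mu}_k,\boldsymbol{\Sigma}_{\beta_k})$, independently $\mathbf{x}_1,\dots,\mathbf{x}_{n+1}\stackrel{iid}{\sim}\mathcal{N}(0,\boldsymbol{\Sigma}_x)$, $y_i=\mathbf{x}_i^\top\boldsymbol{\beta}$ (noiseless). $\mathbf{X}=[\mathbf{x}_1\cdots\mathbf{x}_n]^\top$, $\mathbf{y}=(y_1,\dots,y_n)^\top$, $\mathbf{x}=\mathbf{x}_{n+1}$, $y=y_{n+1}$. Define the debiased mixed-task covariance $\bar{\boldsymbol{\Sigma}}_\beta=\boldsymbol{\Sigma}_x\sum_{k=1}^K\pi_k\boldsymbol{\Sigma}_{\beta_k}$. *)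

theory Defs
  imports "HOL-Probability.Probability"
begin

definition pos_def_mat :: "real^'d^'d \<Rightarrow> bool" where
  "pos_def_mat A \<longleftrightarrow> transpose A = A \<and> (\<forall>v. v \<noteq> 0 \<longrightarrow> v \<bullet> (A *v v) > 0)"

definition mvn_density :: "real^'d \<Rightarrow> real^'d^'d \<Rightarrow> real^'d \<Rightarrow> real" where
  "mvn_density mu S z =
     exp (- (1/2) * ((z - mu) \<bullet> (matrix_inv S *v (z - mu))))
     / sqrt ((2 * pi) ^ CARD('d) * det S)"

definition mvn :: "real^'d \<Rightarrow> real^'d^'d \<Rightarrow> (real^'d) measure" where
  "mvn mu S = density lborel (\<lambda>z. ennreal (mvn_density mu S z))"

(* Task distribution D_k: beta ~ N(mu, Sb), independently x_0,...,x_n iid N(0, Sx).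
   Points are (beta, xs); x_0..x_{n-1} are the rows of X, x_n is the query x. *)
definition task_dist :: "nat \<Rightarrow> real^'d^'d \<Rightarrow> real^'d \<Rightarrow> real^'d^'d
                         \<Rightarrow> ((real^'d) \<times> (nat \<Rightarrow> real^'d)) measure" where
  "task_dist n Sx mu Sb = mvn mu Sb \<Otimes>\<^sub>M (\<Pi>\<^sub>M i\<in>{..n}. mvn 0 Sx)"

(* Squared error of the PGD-type predictor x^T W X^T (y - X mu) + x^T mu vs y = x^T beta,
   with y_i = x_i^T beta (noiseless). Note X^T (y - X mu) = sum_{i<n} x_i (x_i^T beta - x_i^T mu). *)
definition pgd_sq_err :: "nat \<Rightarrow> real^'d^'d \<Rightarrow> real^'d \<Rightarrow> (real^'d) \<times> (nat \<Rightarrow> real^'d) \<Rightarrow> real" where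
  "pgd_sq_err n W mu p =
     (let beta = fst p; xs = snd p; x = xs n;
          Xt_res = (\<Sum>i<n. ((xs i \<bullet> beta) - (xs i \<bullet> mu)) *\<^sub>R xs i)
      in (x \<bullet> (W *v Xt_res) + x \<bullet> mu - x \<bullet> beta)\<^sup>2)"

definition pgd_loss :: "nat \<Rightarrow> nat \<Rightarrow> real^'d^'d \<Rightarrow> (nat \<Rightarrow> real) \<Rightarrow> (nat \<Rightarrow> real^'d)
                        \<Rightarrow> (nat \<Rightarrow> real^'d^'d) \<Rightarrow> real^'d^'d \<Rightarrow> real" where
  "pgd_loss n K Sx pik mu Sb W =
     (\<Sum>k<K. pik k * (\<integral>p. pgd_sq_err n W (mu k) p \<partial>(task_dist n Sx (mu k) (Sb k))))"

end

theory Submission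
  imports Defs
begin

text \<open>
  With \<open>A = Sx\<close>, \<open>B = (\<Sum>k<K. pik k *\<^sub>R Sb k)\<close> and \<open>t = trace (A ** B)\<close>, the second and fourth Gaussian moments turn
  the loss into the quadratic polynomial
  \<open>n tr(W\<^sup>T A W M) - 2 n tr(A W A B) + t\<close> where \<open>M = (n + 1) A B A + t A\<close>. Since \<open>A\<close> and \<open>M\<close> are positive
  definite, completing the square at \<open>W0 = B A M\<^sup>-\<^sup>1\<close> identifies the unique minimizer, and
  \<open>M = ((n + 1) A B + t I) A\<close> rewrites \<open>A W0\<close> into the stated form.

  The Gaussian moments come from an affine change of variables to a standard normal vector one of whose
  coordinates is the normalised projection \<open>u \<bullet> (x - mu)\<close>; mixed moments follow by polarisation.
\<close>

subsection \<open>Linear change of variables\<close>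

text \<open>The obstacle is that \<open>mvn\<close> is given only by its density: total mass,
  projections and moments must all be extracted from Lebesgue integrals. The algebra is short
  because the predictor is debiased. Its error depends on \<open>beta\<close> only through
  \<open>c = beta - mu\<close>, so the task means disappear, and the expected error is linear in the
  covariance of \<open>c\<close>, so the mixture acts only through \<open>B\<close>. The constant
  \<open>n + 1\<close> counts pairs of context rows: the n(n-1) ordered pairs of distinct rows
  contribute a squared mean each, the n coincident pairs contribute twice that square through the
  fourth moment, and the sum n(n+1) leaves n+1 once the common factor n is taken out. The symmetric
  matrix \<open>M\<close> is used because \<open>A B\<close> is in general not symmetric, so
  positivity arguments do not apply to it directly.\<close>

lemma Basis_vec_eq: "(Basis :: (real^'n) set) = range (\<lambda>i. axis i 1)"
  by (auto simp: Basis_vec_def)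

lemma prod_Basis_vec: "(\<Prod>b\<in>(Basis::(real^'n) set). f b) = (\<Prod>i\<in>UNIV. f (axis i 1))"
  unfolding Basis_vec_eq by (subst prod.reindex) (auto simp: inj_on_def axis_eq_axis)

lemma sum_Basis_vec: "(\<Sum>b\<in>(Basis::(real^'n) set). f b) = (\<Sum>i\<in>UNIV. f (axis i 1))"
  unfolding Basis_vec_eq by (subst sum.reindex) (auto simp: inj_on_def axis_eq_axis)

text \<open>Fubini with the coordinate \<open>b\<close> innermost, so that a map changing only this
  coordinate can be handled by a one-dimensional substitution.\<close>

lemma nn_integral_lborel_coord:
  fixes g :: "'a::euclidean_space \<Rightarrow> ennreal"
  assumes b: "b \<in> Basis" and [measurable]: "g \<in> borel_measurable borel"
  shows "(\<integral>\<^sup>+x. g x \<partial>lborel) = (\<integral>\<^sup>+y. \<integral>\<^sup>+t. g ((\<Sum>c\<in>Basis-{b}. y c *\<^sub>R c) + t *\<^sub>R b) \<partial>lborel \<partial>Pi\<^sub>M (Basis-{b}) (\<lambda>_. lborel))"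
proof -
  interpret product_sigma_finite "\<lambda>_::'a. lborel :: real measure" ..
  have "(\<integral>\<^sup>+x. g x \<partial>lborel) = (\<integral>\<^sup>+y. g (\<Sum>c\<in>Basis. y c *\<^sub>R c) \<partial>Pi\<^sub>M (insert b (Basis-{b})) (\<lambda>_. lborel))"
    using b by (simp add: lborel_def[where 'a='a] lborel_eq_real nn_integral_distr insert_absorb)
  also have "\<dots> = (\<integral>\<^sup>+y. \<integral>\<^sup>+t. g (\<Sum>c\<in>Basis. (y(b:=t)) c *\<^sub>R c) \<partial>lborel \<partial>Pi\<^sub>M (Basis-{b}) (\<lambda>_. lborel))"
    using b by (subst product_nn_integral_insert) (auto simp: insert_absorb)
  finally have "(\<integral>\<^sup>+x. g x \<partial>lborel) = \<dots>" .
  moreover have "(\<Sum>c\<in>Basis. (y(b:=t)) c *\<^sub>R c) = (\<Sum>c\<in>Basis-{b}. y c *\<^sub>R c) + t *\<^sub>R b" for y t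
    using b by (subst sum.remove[of _ b]) (auto intro!: sum.cong)
  ultimately show ?thesis by simp
qed

text \<open>With the other coordinates frozen, the shear translates the coordinate along
  \<open>b\<close> by \<open>x \<bullet> c\<close>, an amount independent of that coordinate because
  \<open>b \<noteq> c\<close>.\<close>

lemma nn_integral_lborel_shear:
  fixes g :: "'a::euclidean_space \<Rightarrow> ennreal"
  assumes b: "b \<in> Basis" "c \<in> Basis" "b \<noteq> c" and [measurable]: "g \<in> borel_measurable borel"
  shows "(\<integral>\<^sup>+x. g (x + (x \<bullet> c) *\<^sub>R b) \<partial>lborel) = (\<integral>\<^sup>+x. g x \<partial>lborel)"
proof -
  define v where "v y = (\<Sum>d\<in>Basis-{b}. y d *\<^sub>R d)" for y :: "'a \<Rightarrow> real"
  have "(\<integral>\<^sup>+x. g (x + (x \<bullet> c) *\<^sub>R b) \<partial>lborel)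
     = (\<integral>\<^sup>+y. \<integral>\<^sup>+t. g ((v y + t *\<^sub>R b) + ((v y + t *\<^sub>R b) \<bullet> c) *\<^sub>R b) \<partial>lborel \<partial>Pi\<^sub>M (Basis-{b}) (\<lambda>_. lborel))"
    unfolding v_def by (rule nn_integral_lborel_coord) (use b in auto)
  also have "\<dots> = (\<integral>\<^sup>+y. \<integral>\<^sup>+t. g (v y + t *\<^sub>R b) \<partial>lborel \<partial>Pi\<^sub>M (Basis-{b}) (\<lambda>_. lborel))"
  proof (rule nn_integral_cong)
    fix y
    \<comment> \<open>The factor \<open>1 * t\<close> fits the affine substitution
      \<open>nn_integral_real_affine\<close> with slope 1.\<close>
    have "(v y + t *\<^sub>R b) + ((v y + t *\<^sub>R b) \<bullet> c) *\<^sub>R b = v y + (v y \<bullet> c + 1 * t) *\<^sub>R b" for t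
      using b by (simp add: inner_add_left inner_Basis algebra_simps)
    then show "(\<integral>\<^sup>+t. g ((v y + t *\<^sub>R b) + ((v y + t *\<^sub>R b) \<bullet> c) *\<^sub>R b) \<partial>lborel) = (\<integral>\<^sup>+t. g (v y + t *\<^sub>R b) \<partial>lborel)"
      using nn_integral_real_affine[of "\<lambda>t. g (v y + t *\<^sub>R b)" 1 "v y \<bullet> c"] by (simp only:) simp
  qed
  also have "\<dots> = (\<integral>\<^sup>+x. g x \<partial>lborel)"
    unfolding v_def by (rule nn_integral_lborel_coord[symmetric]) (use b in auto)
  finally show ?thesis .
qed

text \<open>A coordinate permutation pulls boxes back to boxes with permuted side lengths, and the
  values on boxes determine \<open>lborel\<close>.\<close>

lemma nn_integral_lborel_permute:
  fixes g :: "real^'n \<Rightarrow> ennreal" and p :: "'n \<Rightarrow> 'n"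
  assumes p: "bij p" and [measurable]: "g \<in> borel_measurable borel"
  shows "(\<integral>\<^sup>+x. g (\<chi> i. x $ p i) \<partial>lborel) = (\<integral>\<^sup>+x. g x \<partial>lborel)"
proof -
  let ?T = "\<lambda>x::real^'n. (\<chi> i. x $ p i)"
  have T[measurable]: "?T \<in> borel_measurable borel"
    by (intro borel_measurable_continuous_onI continuous_intros)
  have pinv: "p (inv p i) = i" "inv p (p i) = i" for i
    using p by (simp_all add: bij_is_surj surj_f_inv_f bij_is_inj)
  have "(lborel :: (real^'n) measure) = distr lborel borel ?T"
  proof (rule lborel_eqI)
    fix l u :: "real^'n" assume le: "\<And>b. b \<in> Basis \<Longrightarrow> l \<bullet> b \<le> u \<bullet> b"
    then have le': "l $ i \<le> u $ i" for i
      using le[of "axis i 1"] by (simp add: inner_axis)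
    have *: "?T -` box l u = box (\<chi> i. l $ inv p i) (\<chi> i. u $ inv p i)"
    proof -
      have "(\<forall>i. l $ i < x $ p i \<and> x $ p i < u $ i) \<longleftrightarrow> (\<forall>i. l $ inv p i < x $ i \<and> x $ i < u $ inv p i)" for x :: "real^'n"
        using pinv(1)[symmetric] pinv(2) by (metis (no_types))
      then show ?thesis by (simp add: set_eq_iff mem_box_cart)
    qed
    have "emeasure (distr lborel borel ?T) (box l u) = emeasure lborel (box (\<chi> i. l $ inv p i) (\<chi> i. u $ inv p i))"
      by (subst emeasure_distr) (auto simp: *)
    also have "\<dots> = (\<Prod>i\<in>UNIV. u $ inv p i - l $ inv p i)"
      by (subst emeasure_lborel_box) (auto simp: Basis_vec_eq inner_axis le', simp add: prod_Basis_vec inner_axis flip: Basis_vec_eq)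
    also have "(\<Prod>i\<in>UNIV. u $ inv p i - l $ inv p i) = (\<Prod>i\<in>UNIV. u $ i - l $ i)"
      by (rule prod.reindex_bij_betw[OF bij_imp_bij_inv[OF p], of "\<lambda>i. u $ i - l $ i"])
    finally show "emeasure (distr lborel borel ?T) (box l u) = (\<Prod>b\<in>Basis. (u - l) \<bullet> b)"
      by (simp add: prod_Basis_vec inner_axis)
  qed simp
  then have "(\<integral>\<^sup>+x. g x \<partial>lborel) = (\<integral>\<^sup>+x. g x \<partial>distr lborel borel ?T)"
    by (rule arg_cong)
  also have "\<dots> = (\<integral>\<^sup>+x. g (?T x) \<partial>lborel)" by (subst nn_integral_distr) auto
  finally show ?thesis by (rule sym)
qed

lemma measurable_matrix_vector_mult [measurable]:
  fixes A :: "real^'n^'m"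
  shows "(\<lambda>x. A *v x) \<in> borel_measurable borel"
  by (intro borel_measurable_continuous_onI matrix_vector_mult_linear_continuous_on)

text \<open>\<^theory>\<open>HOL-Analysis.Change_Of_Vars\<close> has this only for well-ordered index types, hence the
  direct proof by elementary matrices.\<close>

lemma nn_integral_lborel_linear:
  fixes A :: "real^'n^'n"
  assumes "det A \<noteq> 0" and "g \<in> borel_measurable borel"
  shows "(\<integral>\<^sup>+x. g x \<partial>lborel) = ennreal \<bar>det A\<bar> * (\<integral>\<^sup>+x. g (A *v x) \<partial>lborel)"
proof -
  \<comment> \<open>The determinant condition sits inside \<open>P\<close> because the induction
    also visits singular matrices. All \<open>g\<close> are quantified because the product case
    applies the hypothesis for \<open>B\<close> to \<open>g\<close> composed with
    \<open>A\<close>.\<close>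
  define P where "P A \<longleftrightarrow> (det A \<noteq> 0 \<longrightarrow> (\<forall>g\<in>borel_measurable borel. (\<integral>\<^sup>+x. g x \<partial>lborel) = ennreal \<bar>det A\<bar> * (\<integral>\<^sup>+x. g (A *v x) \<partial>lborel)))"
    for A :: "real^'n^'n"
  have "P A"
  proof (rule induct_matrix_elementary_alt)
    fix A B :: "real^'n^'n"
    assume A: "P A" and B: "P B"
    show "P (A ** B)"
      unfolding P_def
    proof (intro impI ballI)
      fix g :: "real^'n \<Rightarrow> ennreal" assume d: "det (A ** B) \<noteq> 0" and [measurable]: "g \<in> borel_measurable borel"
      have "(\<integral>\<^sup>+x. g x \<partial>lborel) = ennreal \<bar>det A\<bar> * (\<integral>\<^sup>+x. g (A *v x) \<partial>lborel)"
        using d by (intro A[unfolded P_def, rule_format]) (auto simp: det_mul)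
      also have "(\<integral>\<^sup>+x. g (A *v x) \<partial>lborel) = ennreal \<bar>det B\<bar> * (\<integral>\<^sup>+x. g (A *v (B *v x)) \<partial>lborel)"
        using d by (intro B[unfolded P_def, rule_format]) (auto simp: det_mul)
      finally show "(\<integral>\<^sup>+x. g x \<partial>lborel) = ennreal \<bar>det (A ** B)\<bar> * (\<integral>\<^sup>+x. g ((A ** B) *v x) \<partial>lborel)"
        by (simp add: det_mul abs_mult ennreal_mult matrix_vector_mul_assoc mult.assoc)
    qed
  next
    fix A :: "real^'n^'n" and i assume "row i A = 0"
    then show "P A" using det_zero_row(1)[of i A] by (simp add: P_def)
  next
    fix A :: "real^'n^'n" assume A: "\<And>i j. i \<noteq> j \<Longrightarrow> A $ i $ j = 0"
    have dA: "det A = (\<Prod>i\<in>UNIV. A $ i $ i)" by (rule det_diagonal) (rule A)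
    \<comment> \<open>The leading 0 and the sum over \<open>Basis\<close> reproduce the map of
      \<open>lborel_affine_euclidean\<close> at \<open>t = 0\<close>.\<close>
    have Ax: "0 + (\<Sum>b\<in>Basis. (b \<bullet> (A *v b) * (x \<bullet> b)) *\<^sub>R b) = A *v x" for x
    proof -
      have *: "(A *v x) $ i = A $ i $ i * x $ i" for i
        unfolding matrix_vector_mult_def by (simp add: sum.remove[of UNIV i] A)
      have "(axis k 1 \<bullet> (A *v axis k 1) * (x \<bullet> axis k 1)) *\<^sub>R axis k 1 = (\<chi> i. if i = k then A $ k $ k * x $ k else 0)" for k
        by (simp add: vec_eq_iff axis_def inner_axis[unfolded axis_def] inner_axis'[unfolded axis_def]
            matrix_vector_mult_basis[unfolded axis_def] column_def)
      then show ?thesis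
        by (simp add: sum_Basis_vec vec_eq_iff *)
    qed
    show "P A"
      unfolding P_def
    proof (intro impI ballI)
      fix g :: "real^'n \<Rightarrow> ennreal" assume d: "det A \<noteq> 0" and [measurable]: "g \<in> borel_measurable borel"
      have nz: "\<And>j. j \<in> Basis \<Longrightarrow> j \<bullet> (A *v j) \<noteq> 0"
        using d by (auto simp: dA Basis_vec_eq inner_axis' matrix_vector_mult_basis column_def)
      have e: "(\<Prod>b\<in>Basis. \<bar>b \<bullet> (A *v b)\<bar>) = \<bar>det A\<bar>"
        by (auto simp: dA prod_Basis_vec inner_axis' matrix_vector_mult_basis column_def abs_prod)
      have "lborel = density (distr lborel borel (\<lambda>x. A *v x)) (\<lambda>_. ennreal \<bar>det A\<bar>)"
        using lborel_affine_euclidean[where c="\<lambda>b. b \<bullet> (A *v b)" and t=0, OF nz] unfolding Ax e by simp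
      then have "(\<integral>\<^sup>+x. g x \<partial>lborel) = (\<integral>\<^sup>+x. g x \<partial>density (distr lborel borel (\<lambda>x. A *v x)) (\<lambda>_. ennreal \<bar>det A\<bar>))"
        by (rule arg_cong)
      also have "\<dots> = ennreal \<bar>det A\<bar> * (\<integral>\<^sup>+x. g (A *v x) \<partial>lborel)"
        by (simp add: nn_integral_density nn_integral_distr nn_integral_cmult)
      finally show "(\<integral>\<^sup>+x. g x \<partial>lborel) = ennreal \<bar>det A\<bar> * (\<integral>\<^sup>+x. g (A *v x) \<partial>lborel)" .
    qed
  next
    fix m n :: 'n assume "m \<noteq> n"
    let ?p = "Transposition.transpose m n" and ?A = "(\<chi> i j. mat 1 $ i $ Transposition.transpose m n j) :: real^'n^'n"
    have p: "?p permutes UNIV" by (simp add: permutes_swap_id)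
    have d: "\<bar>det ?A\<bar> = 1"
      using det_permute_columns[OF p, of "mat 1 :: real^'n^'n"] by (simp add: abs_mult sign_def)
    have "?A *v x = (\<chi> i. x $ ?p i)" for x :: "real^'n"
    proof -
      have "(\<Sum>j\<in>UNIV. mat 1 $ i $ ?p j * x $ j) = (\<Sum>j\<in>UNIV. if j = ?p i then x $ j else 0)" for i
        by (intro sum.cong) (auto simp: mat_def Transposition.transpose_def)
      then show ?thesis by (simp add: vec_eq_iff matrix_vector_mult_def)
    qed
    then show "P ?A"
      by (auto simp: P_def d nn_integral_lborel_permute permutes_bij[OF p])
  next
    fix m n :: 'n assume mn: "m \<noteq> n"
    let ?A = "(\<chi> i j. of_bool (i = m \<and> j = n \<or> i = j)) :: real^'n^'n"
    have "det ?A = 1"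
    proof -
      \<comment> \<open>The matrix is the identity with row \<open>n\<close> added to row
        \<open>m\<close>, an operation that preserves the determinant.\<close>
      have "?A = (\<chi> k. if k = m then row m (mat 1) + 1 *s row n (mat 1) else row k (mat 1))"
        using mn by (auto simp: vec_eq_iff row_def mat_def)
      then show ?thesis
        using det_row_operation[OF mn, of "mat 1 :: real^'n^'n" 1] by simp
    qed
    moreover have "?A *v x = x + (x \<bullet> axis n 1) *\<^sub>R axis m 1" for x :: "real^'n"
    proof -
      have "(?A *v x) $ i = x $ i + (if i = m then x $ n else 0)" for i
      proof -
        have "(?A *v x) $ i = (\<Sum>j\<in>UNIV. (if j = i then x $ j else 0) + (if j = n then (if i = m then x $ j else 0) else 0))"
          unfolding matrix_vector_mult_def using mn by (auto intro!: sum.cong)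
        then show ?thesis by (simp add: sum.distrib)
      qed
      moreover have "x \<bullet> axis n 1 = x $ n" by (simp add: inner_axis)
      ultimately show ?thesis by (auto simp: vec_eq_iff axis_def)
    qed
    ultimately show "P ?A"
      using mn by (auto simp: P_def nn_integral_lborel_shear axis_eq_axis)
  qed
  with assms show ?thesis unfolding P_def by blast
qed

subsection \<open>Positive definite matrices and whitening\<close>

text \<open>\<open>matrix_inv\<close> is a Hilbert choice, so its value is pinned down by
  uniqueness: a right inverse of a square matrix is two-sided, and two-sided inverses agree.\<close>

lemma matrix_inv_eqI:
  fixes A B :: "real^'n^'n"
  assumes "A ** B = mat 1"
  shows "matrix_inv A = B"
proof -
  have BA: "B ** A = mat 1" using assms matrix_left_right_inverse by blast
  have "A ** matrix_inv A = mat 1 \<and> matrix_inv A ** A = mat 1"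
    unfolding matrix_inv_def by (rule someI[of _ B]) (simp add: assms BA)
  then have "B ** (A ** matrix_inv A) = B" by simp
  then show ?thesis by (simp add: matrix_mul_assoc BA)
qed

lemma pos_def_sym:
  assumes "pos_def_mat S"
  shows "a \<bullet> (S *v b) = b \<bullet> (S *v a)"
  using assms by (metis dot_lmul_matrix inner_commute pos_def_mat_def transpose_matrix_vector)

text \<open>Gram--Schmidt for the inner product given by \<^term>\<open>S\<close>: the next vector is taken orthogonal to all
  \<^term>\<open>S *v h i\<close> in the ordinary sense.\<close>

lemma pos_def_orthonormal_extend:
  fixes S :: "real^'n^'n" and f :: "'n \<Rightarrow> real^'n"
  assumes S: "pos_def_mat S"
    and f: "\<And>i j. i \<in> I \<Longrightarrow> j \<in> I \<Longrightarrow> f i \<bullet> (S *v f j) = of_bool (i = j)"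
  shows "\<exists>h. (\<forall>i\<in>I. h i = f i) \<and> (\<forall>i j. h i \<bullet> (S *v h j) = of_bool (i = j))"
proof -
  have "\<exists>h. (\<forall>i\<in>I. h i = f i) \<and> (\<forall>i\<in>I \<union> J. \<forall>j\<in>I \<union> J. h i \<bullet> (S *v h j) = of_bool (i = j))"
    if "J \<subseteq> - I" for J
    using finite[of J] that
  proof (induction J rule: finite_induct)
    case empty
    then show ?case using f by auto
  next
    case (insert k J)
    then obtain h where h: "\<forall>i\<in>I. h i = f i"
      and hS: "\<forall>i\<in>I \<union> J. \<forall>j\<in>I \<union> J. h i \<bullet> (S *v h j) = of_bool (i = j)"
      by auto
    have k: "k \<notin> I \<union> J" using insert by auto
    \<comment> \<open>Since the index \<open>k\<close> is still free, these vectors are fewer than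
      the dimension, and some nonzero \<open>u\<close> is orthogonal to all of them.\<close>
    have "dim ((\<lambda>i. S *v h i) ` (I \<union> J)) \<le> card ((\<lambda>i. S *v h i) ` (I \<union> J))"
      by (intro dim_le_card') simp
    also have "\<dots> \<le> card (I \<union> J)" by (intro card_image_le) simp
    also have "\<dots> < CARD('n)" using k by (intro psubset_card_mono) auto
    finally have "dim ((\<lambda>i. S *v h i) ` (I \<union> J)) < DIM(real^'n)" by simp
    then obtain u where u: "u \<noteq> 0" "\<And>y. y \<in> span ((\<lambda>i. S *v h i) ` (I \<union> J)) \<Longrightarrow> orthogonal u y"
      by (rule orthogonal_to_subspace_exists) blast
    define c where "c = u \<bullet> (S *v u)"
    have c: "c > 0" using S u by (simp add: pos_def_mat_def c_def)
    have uh: "u \<bullet> (S *v h i) = 0" if "i \<in> I \<union> J" for i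
      using u(2)[OF span_base[OF imageI[OF that]]] by (simp add: orthogonal_def)
    define w where "w = (1 / sqrt c) *\<^sub>R u"
    have wh: "w \<bullet> (S *v h i) = 0" "h i \<bullet> (S *v w) = 0" if "i \<in> I \<union> J" for i
      using uh[OF that] pos_def_sym[OF S, of "h i"] by (simp_all add: w_def)
    have ww: "w \<bullet> (S *v w) = 1"
      using c by (simp add: w_def matrix_vector_mult_scaleR flip: c_def)
    show ?case
      by (rule exI[of _ "h(k := w)"]) (use h hS wh ww k in auto)
  qed
  from this[of "-I"] show ?thesis by auto
qed

text \<open>Choosing one coordinate of the whitened vector to be a multiple of \<^term>\<open>u \<bullet> x\<close> makes the law
  of that projection visible without summing independent normals.\<close>

lemma pos_def_whitening:
  fixes S :: "real^'n^'n" and u :: "real^'n"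
  assumes S: "pos_def_mat S" and u: "u \<noteq> 0"
  obtains Q :: "real^'n^'n" and i where "Q ** S ** transpose Q = mat 1"
    and "\<And>x. (Q *v x) $ i = (u \<bullet> x) / sqrt (u \<bullet> (S *v u))"
proof -
  fix i :: 'n
  define c where "c = u \<bullet> (S *v u)"
  have c: "c > 0" using S u by (simp add: pos_def_mat_def c_def)
  have "((1 / sqrt c) *\<^sub>R u) \<bullet> (S *v ((1 / sqrt c) *\<^sub>R u)) = 1"
    using c by (simp add: matrix_vector_mult_scaleR flip: c_def)
  with pos_def_orthonormal_extend[OF S, of "{i}" "\<lambda>_. (1 / sqrt c) *\<^sub>R u"]
  obtain h where h: "h i = (1 / sqrt c) *\<^sub>R u" "\<And>i j. h i \<bullet> (S *v h j) = of_bool (i = j)"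
    by auto
  define Q where "Q = (\<chi> i. h i)"
  have "((Q ** S ** transpose Q) *v axis b 1) $ a = (mat 1 *v axis b 1) $ a" for a b :: 'n
  proof -
    have "transpose Q *v axis b 1 = h b"
      by (simp add: matrix_vector_mult_basis column_def transpose_def Q_def vec_eq_iff del: transpose_matrix_vector)
    then have "((Q ** S ** transpose Q) *v axis b 1) $ a = h a \<bullet> (S *v h b)"
      by (simp only: matrix_vector_mul_assoc[symmetric] matrix_vector_mul_component) (simp add: Q_def)
    then show ?thesis by (simp add: h(2) axis_def)
  qed
  then have "Q ** S ** transpose Q = mat 1"
    by (simp add: vec_eq_iff matrix_vector_mult_basis column_def)
  moreover have "(Q *v x) $ i = (u \<bullet> x) / sqrt (u \<bullet> (S *v u))" for x
    by (simp add: matrix_vector_mul_component Q_def h(1) flip: c_def)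
  ultimately show ?thesis using that by blast
qed

subsection \<open>Projections of the Gaussian\<close>

lemma prod_std_normal_density:
  "(\<Prod>i\<in>UNIV. std_normal_density (z $ i)) = exp (- (z \<bullet> z) / 2) / sqrt ((2 * pi) ^ CARD('n))"
  for z :: "real^'n"
  unfolding real_sqrt_power
  by (simp add: normal_density_def inner_vec_def prod_dividef exp_sum[symmetric] sum_negf sum_divide_distrib
      power2_eq_square)

text \<open>The hypothesis says that the inverse of \<open>S\<close> is
  \<open>transpose Q ** Q\<close> and that \<open>det S\<close> is the inverse square of
  \<open>det Q\<close>. The exponent becomes the squared norm of \<open>Q *v (x - mu)\<close>, and
  the normalisation leaves the factor \<open>\<bar>det Q\<bar>\<close>.\<close>

lemma mvn_density_whitening:
  fixes S Q :: "real^'n^'n"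
  assumes Q: "Q ** S ** transpose Q = mat 1"
  shows "det Q \<noteq> 0"
    and "mvn_density mu S x = \<bar>det Q\<bar> * (\<Prod>i\<in>UNIV. std_normal_density ((Q *v (x - mu)) $ i))"
proof -
  have d: "det Q * det S * det Q = 1"
    using arg_cong[OF Q, of det] by (simp add: det_mul)
  then show dQ: "det Q \<noteq> 0" by auto
  have "transpose Q ** (Q ** S) = mat 1"
    using Q matrix_left_right_inverse by blast
  then have "S ** (transpose Q ** Q) = mat 1"
    using matrix_left_right_inverse by (metis matrix_mul_assoc)
  then have inv: "matrix_inv S = transpose Q ** Q" by (rule matrix_inv_eqI)
  have "v \<bullet> (transpose Q *v w) = (Q *v v) \<bullet> w" for v w
    by (metis dot_lmul_matrix transpose_matrix_vector transpose_transpose)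
  then have q: "v \<bullet> (matrix_inv S *v v) = (Q *v v) \<bullet> (Q *v v)" for v
    by (simp add: inv flip: matrix_vector_mul_assoc del: transpose_matrix_vector)
  have dS: "det S = 1 / (det Q)\<^sup>2"
    using d dQ by (simp add: field_simps power2_eq_square)
  show "mvn_density mu S x = \<bar>det Q\<bar> * (\<Prod>i\<in>UNIV. std_normal_density ((Q *v (x - mu)) $ i))"
    unfolding mvn_density_def prod_std_normal_density q dS
    by (simp add: real_sqrt_divide real_sqrt_mult)
qed

lemma borel_measurable_mvn_density [measurable]:
  "mvn_density mu S \<in> borel_measurable borel"
  unfolding mvn_density_def by measurable

lemma sets_mvn [simp, measurable_cong]: "sets (mvn mu S) = sets borel"
  and space_mvn [simp]: "space (mvn mu S) = UNIV"
  by (simp_all add: mvn_def)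

text \<open>The factor \<open>\<bar>det Q\<bar>\<close> in the density is exactly the Jacobian of
  \<open>x \<mapsto> Q *v (x - mu)\<close>, so the substitution absorbs it and a standard normal
  density remains.\<close>

lemma nn_integral_mvn_whitening:
  fixes S Q :: "real^'n^'n"
  assumes Q: "Q ** S ** transpose Q = mat 1" and [measurable]: "g \<in> borel_measurable borel"
  shows "(\<integral>\<^sup>+x. g (Q *v (x - mu)) \<partial>mvn mu S)
    = (\<integral>\<^sup>+z. (\<Prod>i\<in>UNIV. ennreal (std_normal_density (z $ i))) * g z \<partial>lborel)"
proof -
  note w = mvn_density_whitening[OF Q]
  have [measurable]: "(\<lambda>x. (Q *v (x - mu)) $ i) \<in> borel_measurable borel" for i
    by (rule measurable_compose[OF _ borel_measurable_nth]) measurable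
  let ?p = "\<lambda>z::real^'n. \<Prod>i\<in>UNIV. ennreal (std_normal_density (z $ i))"
  have [measurable]: "?p \<in> borel_measurable borel" by measurable
  have "(\<integral>\<^sup>+x. g (Q *v (x - mu)) \<partial>mvn mu S)
    = (\<integral>\<^sup>+x. ennreal \<bar>det Q\<bar> * (?p (Q *v (x - mu)) * g (Q *v (x - mu))) \<partial>lborel)"
    unfolding mvn_def w(2)
    by (subst nn_integral_density; measurable) (auto simp: ennreal_mult' prod_ennreal mult.assoc)
  also have "\<dots> = (\<integral>\<^sup>+x. ennreal \<bar>det Q\<bar> * (?p (Q *v (x - mu)) * g (Q *v (x - mu))) \<partial>distr lborel borel ((+) mu))"
    by (simp only: lborel_distr_plus)
  also have "\<dots> = (\<integral>\<^sup>+x. ennreal \<bar>det Q\<bar> * (?p (Q *v x) * g (Q *v x)) \<partial>lborel)"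
    by (subst nn_integral_distr) auto
  also have "\<dots> = ennreal \<bar>det Q\<bar> * (\<integral>\<^sup>+x. (?p (Q *v x) * g (Q *v x)) \<partial>lborel)"
    by (subst nn_integral_cmult) auto
  also have "\<dots> = (\<integral>\<^sup>+z. ?p z * g z \<partial>lborel)"
    by (rule nn_integral_lborel_linear[OF w(1), symmetric]) measurable
  finally show ?thesis .
qed

lemma nn_integral_std_normal_coord:
  fixes g :: "real \<Rightarrow> ennreal" and k :: "'n::finite"
  assumes [measurable]: "g \<in> borel_measurable borel"
  shows "(\<integral>\<^sup>+z. (\<Prod>i\<in>UNIV. ennreal (std_normal_density (z $ i))) * g (z $ k) \<partial>(lborel :: (real^'n) measure))
    = (\<integral>\<^sup>+t. ennreal (std_normal_density t) * g t \<partial>lborel)"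
proof -
  \<comment> \<open>Placing \<open>g\<close> in the factor of coordinate \<open>k\<close> makes the
    integrand a pure product over \<open>Basis\<close>; every other factor integrates to 1.\<close>
  define f where "f b t = ennreal (std_normal_density t) * (if b = axis k 1 then g t else 1)" for b :: "real^'n" and t
  have 1: "(\<integral>\<^sup>+t. ennreal (std_normal_density t) \<partial>lborel) = 1"
    using prob_space.emeasure_space_1[OF prob_space_normal_density[of 1 0]]
    by (simp add: emeasure_density)
  have "(\<Prod>i\<in>UNIV. ennreal (std_normal_density (z $ i))) * g (z $ k) = (\<Prod>b\<in>Basis. f b (z \<bullet> b))" for z :: "real^'n"
    by (simp add: prod_Basis_vec f_def inner_axis axis_eq_axis prod.distrib)
  then have "(\<integral>\<^sup>+z. (\<Prod>i\<in>UNIV. ennreal (std_normal_density (z $ i))) * g (z $ k) \<partial>(lborel :: (real^'n) measure))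
     = (\<Prod>b\<in>Basis. (\<integral>\<^sup>+t. f b t \<partial>lborel))"
    by (simp only:) (rule nn_integral_lborel_prod, auto simp: f_def)
  also have "\<dots> = (\<Prod>i\<in>UNIV. if i = k then (\<integral>\<^sup>+t. ennreal (std_normal_density t) * g t \<partial>lborel) else 1)"
    unfolding prod_Basis_vec by (intro prod.cong) (auto simp: f_def[abs_def] axis_eq_axis 1)
  finally show ?thesis by simp
qed

lemma distr_mvn_inner:
  fixes S :: "real^'n^'n"
  assumes S: "pos_def_mat S" and u: "u \<noteq> 0"
  shows "distr (mvn mu S) borel (\<lambda>x. (u \<bullet> (x - mu)) / sqrt (u \<bullet> (S *v u))) = density lborel std_normal_density"
proof -
  obtain Q :: "real^'n^'n" and i where Q: "Q ** S ** transpose Q = mat 1"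
    and i: "\<And>x. (Q *v x) $ i = (u \<bullet> x) / sqrt (u \<bullet> (S *v u))"
    using pos_def_whitening[OF S u] by blast
  show ?thesis
  proof (rule measure_eqI)
    fix X assume "X \<in> sets (distr (mvn mu S) borel (\<lambda>x. (u \<bullet> (x - mu)) / sqrt (u \<bullet> (S *v u))))"
    then have X[measurable]: "X \<in> sets borel" by simp
    have "emeasure (distr (mvn mu S) borel (\<lambda>x. (u \<bullet> (x - mu)) / sqrt (u \<bullet> (S *v u)))) X
        = (\<integral>\<^sup>+x. indicator X ((u \<bullet> (x - mu)) / sqrt (u \<bullet> (S *v u))) \<partial>mvn mu S)"
      by (subst nn_integral_indicator[symmetric], simp, subst nn_integral_distr) auto
    also have "\<dots> = (\<integral>\<^sup>+x. indicator X ((Q *v (x - mu)) $ i) \<partial>mvn mu S)"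
      by (simp add: i)
    also have "\<dots> = (\<integral>\<^sup>+t. ennreal (std_normal_density t) * indicator X t \<partial>lborel)"
      by (subst nn_integral_mvn_whitening[OF Q]) (auto simp: nn_integral_std_normal_coord)
    finally show "emeasure (distr (mvn mu S) borel (\<lambda>x. (u \<bullet> (x - mu)) / sqrt (u \<bullet> (S *v u)))) X
      = emeasure (density lborel std_normal_density) X"
      by (simp add: emeasure_density)
  qed simp
qed

text \<open>A measure whose image is a probability measure has total mass 1 itself, so a single
  projection settles the normalisation; \<open>axis undefined 1\<close> is merely some nonzero
  vector.\<close>

lemma prob_space_mvn:
  fixes S :: "real^'n^'n"
  assumes S: "pos_def_mat S"
  shows "prob_space (mvn mu S)"
proof -
  have nz: "axis undefined 1 \<noteq> (0 :: real^'n)" by (simp add: axis_eq_0_iff)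
  have "prob_space (distr (mvn mu S) borel (\<lambda>x. (axis undefined 1 \<bullet> (x - mu)) / sqrt (axis undefined 1 \<bullet> (S *v axis undefined 1))))"
    unfolding distr_mvn_inner[OF S nz] by (rule prob_space_normal_density) simp
  then show ?thesis by (rule prob_space_distrD[rotated]) measurable
qed

subsection \<open>Gaussian moments\<close>

text \<open>Random variables with all absolute moments form an algebra, which settles every integrability
  question about polynomials in Gaussian vectors.\<close>

definition all_moments :: "'a measure \<Rightarrow> ('a \<Rightarrow> real) \<Rightarrow> bool" where
  "all_moments M f \<longleftrightarrow> f \<in> borel_measurable M \<and> (\<forall>k. integrable M (\<lambda>x. \<bar>f x\<bar> ^ k))"

lemma all_moments_measurable: "all_moments M f \<Longrightarrow> f \<in> borel_measurable M"
  by (simp add: all_moments_def)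

lemma all_moments_integrable:
  assumes "all_moments M f"
  shows "integrable M f"
proof (rule Bochner_Integration.integrable_bound)
  show "integrable M (\<lambda>x. \<bar>f x\<bar> ^ 1)" "f \<in> borel_measurable M"
    using assms unfolding all_moments_def by blast+
qed simp

lemma (in finite_measure) all_moments_const: "all_moments M (\<lambda>_. c)"
  by (simp add: all_moments_def)

lemma all_moments_add:
  assumes f: "all_moments M f" and g: "all_moments M g"
  shows "all_moments M (\<lambda>x. f x + g x)"
  unfolding all_moments_def
proof (intro conjI allI)
  note [measurable] = f[THEN all_moments_measurable] g[THEN all_moments_measurable]
  show "(\<lambda>x. f x + g x) \<in> borel_measurable M" by measurable
  fix k
  have "\<bar>f x + g x\<bar> ^ k \<le> 2 ^ k * (\<bar>f x\<bar> ^ k + \<bar>g x\<bar> ^ k)" for x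
  proof -
    have "\<bar>f x + g x\<bar> ^ k \<le> (2 * max \<bar>f x\<bar> \<bar>g x\<bar>) ^ k"
      by (intro power_mono) auto
    also have "\<dots> \<le> 2 ^ k * (\<bar>f x\<bar> ^ k + \<bar>g x\<bar> ^ k)"
      by (auto simp: power_mult_distrib max_def)
    finally show ?thesis .
  qed
  moreover have "integrable M (\<lambda>x. 2 ^ k * (\<bar>f x\<bar> ^ k + \<bar>g x\<bar> ^ k))"
    using f g by (auto simp: all_moments_def)
  ultimately show "integrable M (\<lambda>x. \<bar>f x + g x\<bar> ^ k)"
    by (elim Bochner_Integration.integrable_bound) auto
qed

text \<open>From ab \<le> a^2 + b^2: the moment of order k of a product is controlled by moments of
  order 2k of the factors. The order doubles, so closure holds only when all orders are demanded at
  once.\<close>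

lemma all_moments_mult:
  assumes f: "all_moments M f" and g: "all_moments M g"
  shows "all_moments M (\<lambda>x. f x * g x)"
  unfolding all_moments_def
proof (intro conjI allI)
  note [measurable] = f[THEN all_moments_measurable] g[THEN all_moments_measurable]
  show "(\<lambda>x. f x * g x) \<in> borel_measurable M" by measurable
  fix k
  have "\<bar>f x * g x\<bar> ^ k \<le> \<bar>f x\<bar> ^ (2 * k) + \<bar>g x\<bar> ^ (2 * k)" for x
  proof -
    have "\<bar>f x * g x\<bar> ^ k = \<bar>f x\<bar> ^ k * \<bar>g x\<bar> ^ k"
      by (simp add: abs_mult power_mult_distrib)
    also have "\<dots> \<le> (\<bar>f x\<bar> ^ k)\<^sup>2 + (\<bar>g x\<bar> ^ k)\<^sup>2"
      using sum_squares_bound[of "\<bar>f x\<bar> ^ k" "\<bar>g x\<bar> ^ k"] zero_le_power[of "\<bar>f x\<bar>" k] zero_le_power[of "\<bar>g x\<bar>" k]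
        mult_nonneg_nonneg[of "\<bar>f x\<bar> ^ k" "\<bar>g x\<bar> ^ k"] by linarith
    finally show ?thesis by (simp add: power_mult mult.commute flip: power_mult)
  qed
  moreover have "integrable M (\<lambda>x. \<bar>f x\<bar> ^ (2 * k) + \<bar>g x\<bar> ^ (2 * k))"
    using f g by (auto simp: all_moments_def)
  ultimately show "integrable M (\<lambda>x. \<bar>f x * g x\<bar> ^ k)"
    by (elim Bochner_Integration.integrable_bound) auto
qed

lemma (in finite_measure) all_moments_diff:
  assumes f: "all_moments M f" and g: "all_moments M g"
  shows "all_moments M (\<lambda>x. f x - g x)"
  using all_moments_add[OF f all_moments_mult[OF all_moments_const[of "-1"] g]] by simp

lemma (in finite_measure) all_moments_power:
  assumes f: "all_moments M f"
  shows "all_moments M (\<lambda>x. f x ^ k)"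
  by (induction k) (auto intro: all_moments_const all_moments_mult f)

lemma (in finite_measure) all_moments_sum:
  assumes "\<And>i. i \<in> I \<Longrightarrow> all_moments M (f i)"
  shows "all_moments M (\<lambda>x. \<Sum>i\<in>I. f i x)"
  using assms by (induction I rule: infinite_finite_induct) (auto intro: all_moments_const all_moments_add)

lemma all_moments_distr:
  assumes T: "T \<in> measurable M N" and f: "all_moments (distr M N T) f"
  shows "all_moments M (\<lambda>x. f (T x))"
  using f T unfolding all_moments_def by (auto intro: integrable_distr[OF T] measurable_compose)

text \<open>Expanding in the standard basis reduces two random vectors to their linear functionals,
  which is the form in which the Gaussian facts are available.\<close>

lemma (in finite_measure) all_moments_inner:
  fixes X Y :: "'a \<Rightarrow> 'b::euclidean_space"
  assumes "\<And>u. all_moments M (\<lambda>x. u \<bullet> X x)" "\<And>u. all_moments M (\<lambda>x. u \<bullet> Y x)"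
  shows "all_moments M (\<lambda>x. X x \<bullet> Y x)"
proof -
  have "X x \<bullet> Y x = (\<Sum>b\<in>Basis. (b \<bullet> X x) * (b \<bullet> Y x))" for x
    by (subst euclidean_inner) (simp add: inner_commute)
  then show ?thesis
    using assms by (simp add: all_moments_sum all_moments_mult)
qed

lemma all_moments_std_normal: "all_moments (density lborel std_normal_density) (\<lambda>x. x)"
  unfolding all_moments_def
  by (auto simp: integrable_density integrable_std_normal_moment_abs)

text \<open>Multiplying by the standard deviation instead of dividing admits \<open>u = 0\<close>,
  where both sides are the point mass at 0. Polarisation needs this case, since \<open>p - q\<close>
  may vanish.\<close>

lemma distr_mvn_inner_scaled:
  fixes S :: "real^'n^'n"
  assumes S: "pos_def_mat S"
  shows "distr (mvn mu S) borel (\<lambda>x. u \<bullet> (x - mu))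
    = distr (density lborel std_normal_density) borel (\<lambda>t. sqrt (u \<bullet> (S *v u)) * t)"
proof (cases "u = 0")
  case True
  interpret A: prob_space "mvn mu S" by (rule prob_space_mvn[OF S])
  interpret B: prob_space "density lborel std_normal_density" by (rule prob_space_normal_density) simp
  show ?thesis
    by (rule measure_eqI) (auto simp: True emeasure_distr A.emeasure_space_1 B.emeasure_space_1[simplified] vimage_def split: if_splits)
next
  case False
  then have "sqrt (u \<bullet> (S *v u)) > 0" using S by (simp add: pos_def_mat_def)
  then show ?thesis
    unfolding distr_mvn_inner[OF S False, of mu, symmetric]
    by (subst distr_distr) (auto simp: comp_def)
qed

lemma
  fixes S :: "real^'n^'n"
  assumes S: "pos_def_mat S"
  shows all_moments_mvn: "all_moments (mvn mu S) (\<lambda>x. u \<bullet> (x - mu))"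
    and mvn_moment2: "(\<integral>x. (u \<bullet> (x - mu))\<^sup>2 \<partial>mvn mu S) = u \<bullet> (S *v u)"
    and mvn_moment4: "(\<integral>x. (u \<bullet> (x - mu)) ^ 4 \<partial>mvn mu S) = 3 * (u \<bullet> (S *v u))\<^sup>2"
proof -
  interpret B: prob_space "density lborel std_normal_density" by (rule prob_space_normal_density) simp
  have nn: "u \<bullet> (S *v u) \<ge> 0"
    using S by (cases "u = 0") (auto simp: pos_def_mat_def intro: less_imp_le)
  \<comment> \<open>The last factor is the moment of order \<open>2 * k\<close> of a standard normal
    variable: 1 for \<open>k = 1\<close> and 3 for \<open>k = 2\<close>.\<close>
  have m: "(\<integral>x. (u \<bullet> (x - mu)) ^ (2 * k) \<partial>mvn mu S) = (u \<bullet> (S *v u)) ^ k * (fact (2 * k) / (2 ^ k * fact k))" for k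
  proof -
    have "(\<integral>x. (u \<bullet> (x - mu)) ^ (2 * k) \<partial>mvn mu S) = (\<integral>t. t ^ (2 * k) \<partial>distr (mvn mu S) borel (\<lambda>x. u \<bullet> (x - mu)))"
      by (subst integral_distr) auto
    also have "\<dots> = (\<integral>t. (sqrt (u \<bullet> (S *v u)) * t) ^ (2 * k) \<partial>density lborel std_normal_density)"
      unfolding distr_mvn_inner_scaled[OF S] by (subst integral_distr) auto
    also have "\<dots> = (\<integral>t. (u \<bullet> (S *v u)) ^ k * (std_normal_density t * t ^ (2 * k)) \<partial>lborel)"
    proof -
      have "(sqrt (u \<bullet> (S *v u)) * t) ^ (2 * k) = (u \<bullet> (S *v u)) ^ k * t ^ (2 * k)" for t
        using nn by (simp only: power_mult power_mult_distrib real_sqrt_pow2)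
      then show ?thesis by (subst integral_density) (auto simp: mult_ac)
    qed
    finally show ?thesis by (simp add: integral_std_normal_moment_even)
  qed
  show "(\<integral>x. (u \<bullet> (x - mu))\<^sup>2 \<partial>mvn mu S) = u \<bullet> (S *v u)"
    using m[of 1] by simp
  show "(\<integral>x. (u \<bullet> (x - mu)) ^ 4 \<partial>mvn mu S) = 3 * (u \<bullet> (S *v u))\<^sup>2"
    using m[of 2] by (simp add: fact_numeral)
  have "all_moments (distr (mvn mu S) borel (\<lambda>x. u \<bullet> (x - mu))) (\<lambda>t. t)"
    unfolding distr_mvn_inner_scaled[OF S]
    using all_moments_mult[OF B.all_moments_const[of "sqrt (u \<bullet> (S *v u))"] all_moments_std_normal]
    by (auto simp: all_moments_def integrable_distr_eq)
  from all_moments_distr[OF _ this] show "all_moments (mvn mu S) (\<lambda>x. u \<bullet> (x - mu))"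
    by simp
qed

lemma mvn_covariance:
  fixes S :: "real^'n^'n"
  assumes S: "pos_def_mat S"
  shows "(\<integral>x. (p \<bullet> (x - mu)) * (q \<bullet> (x - mu)) \<partial>mvn mu S) = p \<bullet> (S *v q)"
proof -
  interpret A: prob_space "mvn mu S" by (rule prob_space_mvn[OF S])
  note int = all_moments_integrable A.all_moments_power all_moments_mvn[OF S]
  have "(\<integral>x. (p \<bullet> (x - mu)) * (q \<bullet> (x - mu)) \<partial>mvn mu S)
    = (\<integral>x. (((p + q) \<bullet> (x - mu))\<^sup>2 - (p \<bullet> (x - mu))\<^sup>2 - (q \<bullet> (x - mu))\<^sup>2) / 2 \<partial>mvn mu S)"
  proof -
    have "a * b = ((a + b)\<^sup>2 - a\<^sup>2 - b\<^sup>2) / 2" for a b :: real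
      by (simp add: power2_eq_square algebra_simps)
    then show ?thesis by (simp only: inner_add_left)
  qed
  also have "\<dots> = ((p + q) \<bullet> (S *v (p + q)) - p \<bullet> (S *v p) - q \<bullet> (S *v q)) / 2"
    by (simp add: int mvn_moment2[OF S])
  also have "\<dots> = p \<bullet> (S *v q)"
    by (simp add: matrix_vector_right_distrib inner_add_left inner_add_right pos_def_sym[OF S, of q p])
  finally show ?thesis .
qed

text \<open>Polarisation: \<open>12 p^2 q^2 = (p+q)^4 + (p-q)^4 - 2 p^4 - 2 q^4\<close>.\<close>

lemma mvn_fourth_moment:
  fixes S :: "real^'n^'n"
  assumes S: "pos_def_mat S"
  shows "(\<integral>x. ((p \<bullet> (x - mu)) * (q \<bullet> (x - mu)))\<^sup>2 \<partial>mvn mu S)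
    = (p \<bullet> (S *v p)) * (q \<bullet> (S *v q)) + 2 * (p \<bullet> (S *v q))\<^sup>2"
proof -
  interpret A: prob_space "mvn mu S" by (rule prob_space_mvn[OF S])
  note int = all_moments_integrable A.all_moments_power all_moments_mvn[OF S]
  have "(\<integral>x. ((p \<bullet> (x - mu)) * (q \<bullet> (x - mu)))\<^sup>2 \<partial>mvn mu S)
    = (\<integral>x. (((p + q) \<bullet> (x - mu)) ^ 4 + ((p - q) \<bullet> (x - mu)) ^ 4 - 2 * (p \<bullet> (x - mu)) ^ 4 - 2 * (q \<bullet> (x - mu)) ^ 4) / 12 \<partial>mvn mu S)"
  proof -
    have "(a * b)\<^sup>2 = ((a + b) ^ 4 + (a - b) ^ 4 - 2 * a ^ 4 - 2 * b ^ 4) / 12" for a b :: real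
      by (simp add: power2_eq_square power4_eq_xxxx algebra_simps)
    then show ?thesis by (simp only: inner_add_left inner_diff_left)
  qed
  also have "\<dots> = (3 * ((p + q) \<bullet> (S *v (p + q)))\<^sup>2 + 3 * ((p - q) \<bullet> (S *v (p - q)))\<^sup>2
      - 2 * (3 * (p \<bullet> (S *v p))\<^sup>2) - 2 * (3 * (q \<bullet> (S *v q))\<^sup>2)) / 12"
    by (simp add: int mvn_moment4[OF S])
  also have "\<dots> = (p \<bullet> (S *v p)) * (q \<bullet> (S *v q)) + 2 * (p \<bullet> (S *v q))\<^sup>2"
  proof -
    have a: "(p + q) \<bullet> (S *v (p + q)) = p \<bullet> (S *v p) + 2 * (p \<bullet> (S *v q)) + q \<bullet> (S *v q)"
      "(p - q) \<bullet> (S *v (p - q)) = p \<bullet> (S *v p) - 2 * (p \<bullet> (S *v q)) + q \<bullet> (S *v q)"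
      by (simp_all add: matrix_vector_right_distrib matrix_vector_mult_diff_distrib inner_add_left inner_add_right
        inner_diff_left inner_diff_right pos_def_sym[OF S, of q p])
    show ?thesis unfolding a by (simp add: power2_eq_square algebra_simps)
  qed
  finally show ?thesis .
qed

lemma mvn_quadratic_form:
  fixes S R :: "real^'n^'n"
  assumes S: "pos_def_mat S"
  shows "(\<integral>x. (x - mu) \<bullet> (R *v (x - mu)) \<partial>mvn mu S) = trace (R ** S)"
proof -
  interpret A: prob_space "mvn mu S" by (rule prob_space_mvn[OF S])
  note int = all_moments_integrable all_moments_mult all_moments_mvn[OF S]
  \<comment> \<open>One term per row of \<open>R\<close>, each a product of two linear forms and
    hence a covariance.\<close>
  have "(x - mu) \<bullet> (R *v (x - mu)) = (\<Sum>i\<in>UNIV. (axis i 1 \<bullet> (x - mu)) * (R $ i \<bullet> (x - mu)))" for x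
    by (simp add: inner_vec_def[of "x - mu"] matrix_vector_mul_component inner_axis')
  then have "(\<integral>x. (x - mu) \<bullet> (R *v (x - mu)) \<partial>mvn mu S) = (\<Sum>i\<in>UNIV. axis i 1 \<bullet> (S *v (R $ i)))"
    by (simp add: int mvn_covariance[OF S])
  also have "\<dots> = (\<Sum>i\<in>UNIV. R $ i \<bullet> (S *v axis i 1))"
    by (simp only: pos_def_sym[OF S])
  also have "\<dots> = trace (R ** S)"
    by (simp add: trace_def matrix_vector_mult_basis column_def matrix_matrix_mult_def inner_vec_def)
  finally show ?thesis .
qed

subsection \<open>Sums over independent samples\<close>

lemma all_moments_PiM_component:
  assumes "prob_space N" "i \<in> I" "all_moments N f"
  shows "all_moments (\<Pi>\<^sub>M i\<in>I. N) (\<lambda>x. f (x i))"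
proof (rule all_moments_distr[of "\<lambda>x. x i" _ N f])
  have "distr (\<Pi>\<^sub>M i\<in>I. N) N (\<lambda>x. x i) = N"
    using assms by (intro distr_PiM_component[of I "\<lambda>_. N"]) auto
  then show "all_moments (distr (\<Pi>\<^sub>M i\<in>I. N) N (\<lambda>x. x i)) f"
    using assms by simp
qed (use assms in simp)

lemma distr_pair_fst:
  assumes "prob_space N" "sigma_finite_measure M"
  shows "distr (M \<Otimes>\<^sub>M N) M fst = M"
proof (rule measure_eqI)
  interpret N: prob_space N by fact
  interpret M: sigma_finite_measure M by fact
  interpret pair_sigma_finite M N ..
  fix A assume "A \<in> sets (distr (M \<Otimes>\<^sub>M N) M fst)"
  then have A: "A \<in> sets M" by simp
  then have "fst -` A \<inter> space (M \<Otimes>\<^sub>M N) = A \<times> space N"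
    using sets.sets_into_space by (auto simp: space_pair_measure)
  then show "emeasure (distr (M \<Otimes>\<^sub>M N) M fst) A = emeasure M A"
    using A by (simp add: emeasure_distr N.emeasure_pair_measure_Times N.emeasure_space_1)
qed simp

lemma distr_pair_snd:
  assumes "prob_space M" "sigma_finite_measure N"
  shows "distr (M \<Otimes>\<^sub>M N) N snd = N"
proof (rule measure_eqI)
  interpret M: prob_space M by fact
  interpret N: sigma_finite_measure N by fact
  interpret pair_sigma_finite M N ..
  fix A assume "A \<in> sets (distr (M \<Otimes>\<^sub>M N) N snd)"
  then have A: "A \<in> sets N" by simp
  then have "snd -` A \<inter> space (M \<Otimes>\<^sub>M N) = space M \<times> A"
    using sets.sets_into_space by (auto simp: space_pair_measure)
  then show "emeasure (distr (M \<Otimes>\<^sub>M N) N snd) A = emeasure N A"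
    using A by (simp add: emeasure_distr N.emeasure_pair_measure_Times M.emeasure_space_1)
qed simp

text \<open>Integrating out one sample of mean \<open>m\<close> and second moment \<open>v\<close>
  replaces the shift \<open>s\<close> by \<open>s - m\<close> and adds the variance
  \<open>v - m\<^sup>2\<close>. This is why \<open>s\<close> is present and generalised in the
  induction.\<close>

lemma integral_iid_sum_square:
  fixes g :: "'a \<Rightarrow> real" and s :: real
  assumes N: "prob_space N" and g: "all_moments N g" and I: "finite I"
  shows "(\<integral>x. ((\<Sum>i\<in>I. g (x i)) - s)\<^sup>2 \<partial>(\<Pi>\<^sub>M i\<in>I. N))
    = real (card I) * (\<integral>x. (g x)\<^sup>2 \<partial>N) + real (card I) * (real (card I) - 1) * (\<integral>x. g x \<partial>N)\<^sup>2
      - 2 * real (card I) * s * (\<integral>x. g x \<partial>N) + s\<^sup>2"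
  using I
proof (induction I arbitrary: s rule: finite_induct)
  case empty
  then show ?case by (simp add: PiM_empty)
next
  case (insert k I)
  interpret N: prob_space N by fact
  interpret product_sigma_finite "\<lambda>_. N" ..
  interpret P: prob_space "\<Pi>\<^sub>M i\<in>insert k I. N" by (rule prob_space_PiM) (rule N)
  interpret Q: prob_space "\<Pi>\<^sub>M i\<in>I. N" by (rule prob_space_PiM) (rule N)
  define m where "m = (\<integral>x. g x \<partial>N)"
  define v where "v = (\<integral>x. (g x)\<^sup>2 \<partial>N)"
  have gk: "all_moments (\<Pi>\<^sub>M i\<in>insert k I. N) (\<lambda>x. g (x i))" if "i \<in> insert k I" for i
    using that by (intro all_moments_PiM_component N g)
  have gI: "all_moments (\<Pi>\<^sub>M i\<in>I. N) (\<lambda>x. g (x i))" if "i \<in> I" for i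
    using that by (intro all_moments_PiM_component N g)
  have int: "integrable (\<Pi>\<^sub>M i\<in>insert k I. N) (\<lambda>x. ((\<Sum>i\<in>insert k I. g (x i)) - s)\<^sup>2)"
    by (intro all_moments_integrable P.all_moments_power P.all_moments_diff P.all_moments_sum P.all_moments_const gk)
  have "(\<integral>x. ((\<Sum>i\<in>insert k I. g (x i)) - s)\<^sup>2 \<partial>(\<Pi>\<^sub>M i\<in>insert k I. N))
    = (\<integral>x. (\<integral>y. ((\<Sum>i\<in>insert k I. g ((x(k:=y)) i)) - s)\<^sup>2 \<partial>N) \<partial>(\<Pi>\<^sub>M i\<in>I. N))"
    by (rule product_integral_insert[OF insert(1,2) int])
  also have "\<dots> = (\<integral>x. ((\<Sum>i\<in>I. g (x i)) - (s - m))\<^sup>2 + (v - m\<^sup>2) \<partial>(\<Pi>\<^sub>M i\<in>I. N))"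
  proof (rule Bochner_Integration.integral_cong[OF refl])
    fix x
    define T where "T = (\<Sum>i\<in>I. g (x i)) - s"
    have "(\<Sum>i\<in>I. g ((x(k:=y)) i)) = (\<Sum>i\<in>I. g (x i))" for y
      using insert(2) by (intro sum.cong) auto
    then have "((\<Sum>i\<in>insert k I. g ((x(k:=y)) i)) - s)\<^sup>2 = (g y)\<^sup>2 + 2 * T * g y + T\<^sup>2" for y
      using insert(1,2) by (simp add: T_def power2_eq_square algebra_simps)
    then have "(\<integral>y. ((\<Sum>i\<in>insert k I. g ((x(k:=y)) i)) - s)\<^sup>2 \<partial>N) = v + 2 * T * m + T\<^sup>2"
      by (simp add: v_def m_def all_moments_integrable N.all_moments_power g N.prob_space)
    then show "(\<integral>y. ((\<Sum>i\<in>insert k I. g ((x(k:=y)) i)) - s)\<^sup>2 \<partial>N) = ((\<Sum>i\<in>I. g (x i)) - (s - m))\<^sup>2 + (v - m\<^sup>2)"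
      by (simp add: T_def power2_eq_square algebra_simps)
  qed
  also have "\<dots> = (\<integral>x. ((\<Sum>i\<in>I. g (x i)) - (s - m))\<^sup>2 \<partial>(\<Pi>\<^sub>M i\<in>I. N)) + (v - m\<^sup>2)"
    by (subst Bochner_Integration.integral_add)
       (auto intro!: all_moments_integrable Q.all_moments_power Q.all_moments_diff Q.all_moments_sum Q.all_moments_const gI
        simp: Q.prob_space)
  also have "\<dots> = real (card (insert k I)) * v + real (card (insert k I)) * (real (card (insert k I)) - 1) * m\<^sup>2
      - 2 * real (card (insert k I)) * s * m + s\<^sup>2"
    unfolding insert.IH m_def[symmetric] v_def[symmetric]
    using insert(1,2) by (simp add: power2_eq_square algebra_simps)
  finally show ?case by (simp only: m_def v_def)
qed

lemma integral_PiM_lessThan_Suc: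
  fixes f :: "(nat \<Rightarrow> 'a) \<Rightarrow> real"
  assumes N: "prob_space N" and f: "integrable (\<Pi>\<^sub>M i\<in>{..n}. N) f"
    and h: "\<And>z. z \<in> space N \<Longrightarrow> (\<integral>x. f (x(n := z)) \<partial>(\<Pi>\<^sub>M i\<in>{..<n}. N)) = h z"
    and [measurable]: "h \<in> borel_measurable N"
  shows "(\<integral>x. f x \<partial>(\<Pi>\<^sub>M i\<in>{..n}. N)) = (\<integral>z. h z \<partial>N)"
proof -
  interpret N: prob_space N by fact
  interpret product_sigma_finite "\<lambda>_. N" ..
  \<comment> \<open>The query has index \<open>n\<close>; as the first block it becomes the outer
    variable, with the \<open>n\<close> context rows integrated inside.\<close>
  have e: "{..n} = {n} \<union> {..<n}" by auto
  have "(\<integral>x. f x \<partial>(\<Pi>\<^sub>M i\<in>{..n}. N))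
    = (\<integral>x. (\<integral>y. f (merge {n} {..<n} (x, y)) \<partial>(\<Pi>\<^sub>M i\<in>{..<n}. N)) \<partial>(\<Pi>\<^sub>M i\<in>{n}. N))"
    using f unfolding e by (intro product_integral_fold) auto
  also have "\<dots> = (\<integral>x. h (x n) \<partial>(\<Pi>\<^sub>M i\<in>{n}. N))"
  proof (rule Bochner_Integration.integral_cong[OF refl])
    fix x assume "x \<in> space (\<Pi>\<^sub>M i\<in>{n}. N)"
    then have z: "x n \<in> space N" by (auto simp: space_PiM)
    have "(\<integral>y. f (merge {n} {..<n} (x, y)) \<partial>(\<Pi>\<^sub>M i\<in>{..<n}. N)) = (\<integral>y. f (y(n := x n)) \<partial>(\<Pi>\<^sub>M i\<in>{..<n}. N))"
    proof (rule Bochner_Integration.integral_cong[OF refl])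
      fix y assume "y \<in> space (\<Pi>\<^sub>M i\<in>{..<n}. N)"
      \<comment> \<open>Beyond index \<open>n\<close> both functions are \<open>undefined\<close>,
        because \<open>y\<close> is extensional on \<open>{..<n}\<close>.\<close>
      then have "merge {n} {..<n} (x, y) = y(n := x n)"
        by (auto simp: merge_def space_PiM PiE_def extensional_def)
      then show "f (merge {n} {..<n} (x, y)) = f (y(n := x n))" by simp
    qed
    then show "(\<integral>y. f (merge {n} {..<n} (x, y)) \<partial>(\<Pi>\<^sub>M i\<in>{..<n}. N)) = h (x n)"
      using h[OF z] by simp
  qed
  also have "\<dots> = (\<integral>z. h z \<partial>N)"
    by (rule product_integral_singleton) measurable
  finally show ?thesis .
qed

subsection \<open>Matrix traces\<close>

lemma inner_matrix_vector: "x \<bullet> (A *v y) = (transpose A *v x) \<bullet> y" for A :: "real^'n^'m"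
  by (simp add: dot_lmul_matrix)

lemma matrix_add_rdistrib: "(A + B) ** C = A ** C + B ** C"
  for A B :: "real^'n^'m" and C :: "real^'k^'n"
  by (simp add: matrix_matrix_mult_def vec_eq_iff sum.distrib algebra_simps)

lemma matrix_mul_scaleR_left: "(c *\<^sub>R A) ** B = c *\<^sub>R (A ** B)"
  and matrix_mul_scaleR_right: "A ** (c *\<^sub>R B) = c *\<^sub>R (A ** B)"
  for A :: "real^'n^'m" and B :: "real^'k^'n"
  by (simp_all add: matrix_matrix_mult_def vec_eq_iff sum_distrib_left mult_ac)

lemma matrix_mul_sum_right: "A ** (\<Sum>k\<in>I. B k) = (\<Sum>k\<in>I. A ** B k)"
  for A :: "real^'n^'m" and B :: "'i \<Rightarrow> real^'k^'n"
  by (simp add: matrix_matrix_mult_def vec_eq_iff sum_distrib_left sum.swap[of _ _ I])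

lemma trace_transpose: "trace (transpose A) = trace A"
  by (simp add: trace_def transpose_def)

lemma trace_scaleR: "trace (c *\<^sub>R A) = c * trace A" for A :: "real^'n^'n"
  by (simp add: trace_def sum_distrib_left)

lemma trace_sum: "trace (\<Sum>k\<in>I. A k) = (\<Sum>k\<in>I. trace (A k))" for A :: "'i \<Rightarrow> real^'n^'n"
  by (induction I rule: infinite_finite_induct) (simp_all add: trace_add, simp_all add: trace_def)

lemma transpose_add: "transpose (A + B) = transpose A + transpose B"
  by (simp add: transpose_def vec_eq_iff)

lemma transpose_sum: "transpose (\<Sum>k\<in>I. A k) = (\<Sum>k\<in>I. transpose (A k))" for A :: "'i \<Rightarrow> real^'n^'m"
  by (simp add: transpose_def vec_eq_iff)

text \<open>Splits the trace into one quadratic form per column of \<open>G\<close>, which makes its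
  sign visible when \<open>A\<close> is positive definite.\<close>

lemma trace_cong_diag: "trace (transpose G ** A ** G) = (\<Sum>j\<in>UNIV. column j G \<bullet> (A *v column j G))"
  for A :: "real^'n^'n" and G :: "real^'m^'n"
proof -
  have "(transpose G ** A ** G) $ j $ j = column j G \<bullet> (A *v column j G)" for j
  proof -
    have "(transpose G ** A ** G) $ j $ j = ((transpose G ** A ** G) *v axis j 1) $ j"
      by (simp add: matrix_vector_mult_basis column_def)
    also have "\<dots> = transpose G $ j \<bullet> (A *v (G *v axis j 1))"
      by (simp only: matrix_vector_mul_assoc[symmetric] matrix_vector_mul_component)
    also have "\<dots> = column j G \<bullet> (A *v column j G)"
      by (simp add: matrix_vector_mult_basis) (simp add: transpose_def column_def)
    finally show ?thesis .
  qed
  then show ?thesis by (simp add: trace_def)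
qed

section \<open>Consequences of positive definiteness: factorization, traces, convex
  combinations\<close>

lemma pos_def_factorization:
  fixes S :: "real^'n^'n"
  assumes "pos_def_mat S"
  obtains Q R :: "real^'n^'n" where "S = R ** transpose R" "R ** Q = mat 1"
proof -
  have nz: "axis undefined 1 \<noteq> (0 :: real^'n)" by (simp add: axis_eq_0_iff)
  \<comment> \<open>Any whitening matrix serves; its inverse \<open>R\<close> plays the part of a
    square root of \<open>S\<close>.\<close>
  obtain Q :: "real^'n^'n" where Q: "Q ** S ** transpose Q = mat 1"
    using pos_def_whitening[OF assms nz] by blast
  then have "Q ** (S ** transpose Q) = mat 1" by (simp add: matrix_mul_assoc)
  then obtain R :: "real^'n^'n" where R: "R ** Q = mat 1"
    using matrix_left_right_inverse by blast
  have R': "transpose Q ** transpose R = mat 1"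
    using arg_cong[OF R, of transpose] by (simp add: matrix_transpose_mul)
  have "R ** transpose R = R ** (Q ** S ** transpose Q) ** transpose R" by (simp add: Q)
  also have "\<dots> = (R ** Q) ** S ** (transpose Q ** transpose R)" by (simp only: matrix_mul_assoc)
  also have "\<dots> = S" by (simp add: R R')
  finally show ?thesis using that R by metis
qed

text \<open>With \<open>S = R ** transpose R\<close>, cyclicity turns the trace into that of
  \<open>transpose G ** A ** G\<close> for \<open>G = H ** R\<close>. Invertibility of
  \<open>R\<close> keeps \<open>G\<close> nonzero, and a nonzero column makes the sum strictly
  positive.\<close>

lemma trace_pos_def_pos:
  fixes A S H :: "real^'n^'n"
  assumes A: "pos_def_mat A" and S: "pos_def_mat S" and H: "H \<noteq> 0"
  shows "trace (transpose H ** A ** H ** S) > 0"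
proof -
  obtain Q R :: "real^'n^'n" where SR: "S = R ** transpose R" and RQ: "R ** Q = mat 1"
    by (rule pos_def_factorization[OF S])
  define G where "G = H ** R"
  have "H = G ** Q" by (simp add: G_def RQ flip: matrix_mul_assoc)
  with H have "G \<noteq> 0" by auto
  then obtain j where j: "column j G \<noteq> 0" by (auto simp: column_def vec_eq_iff)
  have nn: "v \<bullet> (A *v v) \<ge> 0" for v
    using A by (cases "v = 0") (auto simp: pos_def_mat_def intro: less_imp_le)
  have "trace (transpose H ** A ** H ** S) = trace (transpose R ** (transpose H ** A ** H ** R))"
    unfolding SR by (subst (2) trace_mul_sym) (simp only: matrix_mul_assoc)
  also have "\<dots> = trace (transpose G ** A ** G)"
    by (simp only: G_def matrix_transpose_mul matrix_mul_assoc)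
  also have "\<dots> > 0"
    unfolding trace_cong_diag using A j nn by (intro sum_pos2[of _ j]) (auto simp: pos_def_mat_def)
  finally show ?thesis .
qed

lemma pos_def_invertible:
  fixes S :: "real^'n^'n"
  assumes "pos_def_mat S"
  obtains T where "S ** T = mat 1"
proof -
  have "x = 0" if "S *v x = 0" for x
    using assms that by (force simp: pos_def_mat_def)
  then obtain T where "T ** S = mat 1"
    using matrix_left_invertible_ker by blast
  then show ?thesis using that matrix_left_right_inverse by blast
qed

lemma pos_def_convex_sum:
  fixes S :: "'i \<Rightarrow> real^'n^'n"
  assumes S: "\<And>k. k \<in> I \<Longrightarrow> pos_def_mat (S k)" and c: "\<And>k. k \<in> I \<Longrightarrow> c k \<ge> 0" and c1: "(\<Sum>k\<in>I. c k) = 1"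
  shows "pos_def_mat (\<Sum>k\<in>I. c k *\<^sub>R S k)"
  unfolding pos_def_mat_def
proof (intro conjI allI impI)
  show "transpose (\<Sum>k\<in>I. c k *\<^sub>R S k) = (\<Sum>k\<in>I. c k *\<^sub>R S k)"
    using S by (auto simp: transpose_sum transpose_scalar pos_def_mat_def)
  fix v :: "real^'n" assume v: "v \<noteq> 0"
  have I: "finite I" using c1 by (metis sum.infinite zero_neq_one)
  \<comment> \<open>Weights summing to 1 cannot all vanish; one positive weight provides the strict
    inequality.\<close>
  obtain j where j: "j \<in> I" "c j > 0"
    using c c1 by (metis less_eq_real_def sum.neutral zero_neq_one)
  have "(\<Sum>k\<in>I. c k *\<^sub>R S k) *v v = (\<Sum>k\<in>I. c k *\<^sub>R (S k *v v))"
    using I by (induction I rule: finite_induct)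
       (simp_all add: matrix_vector_mult_add_rdistrib scaleR_matrix_vector_assoc)
  then have "v \<bullet> ((\<Sum>k\<in>I. c k *\<^sub>R S k) *v v) = (\<Sum>k\<in>I. c k * (v \<bullet> (S k *v v)))"
    by (simp add: inner_sum_right)
  also have "\<dots> > 0"
  proof -
    have "v \<bullet> (S k *v v) > 0" if "k \<in> I" for k
      using S[OF that] v by (simp add: pos_def_mat_def)
    then show ?thesis
      using c j I by (intro sum_pos2[of _ j]) (simp_all add: less_imp_le)
  qed
  finally show "v \<bullet> ((\<Sum>k\<in>I. c k *\<^sub>R S k) *v v) > 0" .
qed

subsection \<open>The loss as a quadratic function\<close>

text \<open>\<open>X\<close> and \<open>C\<close> are kept abstract because the result is needed
  twice: over the samples with a fixed vector in place of \<open>C\<close>, and over the full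
  product with \<open>C\<close> random.\<close>

lemma (in finite_measure) all_moments_residual:
  fixes W :: "real^'d^'d" and n :: nat
  assumes X: "\<And>i u. i \<le> n \<Longrightarrow> all_moments M (\<lambda>p. u \<bullet> X p i)" and C: "\<And>u. all_moments M (\<lambda>p. u \<bullet> C p)"
  shows "all_moments M (\<lambda>p. ((\<Sum>i<n. ((transpose W *v X p n) \<bullet> X p i) * (C p \<bullet> X p i)) - X p n \<bullet> C p)\<^sup>2)"
proof -
  have 1: "all_moments M (\<lambda>p. (transpose W *v X p n) \<bullet> X p i)" if "i < n" for i
    by (rule all_moments_inner) (use X[OF less_imp_le[OF that]] X[OF order_refl] in \<open>auto simp: inner_matrix_vector simp del: transpose_matrix_vector\<close>)
  have 2: "all_moments M (\<lambda>p. C p \<bullet> X p i)" if "i < n" for i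
    by (rule all_moments_inner) (use X[OF less_imp_le[OF that]] C in auto)
  have 3: "all_moments M (\<lambda>p. X p n \<bullet> C p)"
    by (rule all_moments_inner) (use X C in auto)
  show ?thesis
    by (rule all_moments_power, rule all_moments_diff, rule all_moments_sum, rule all_moments_mult) (simp_all only: 1 2 3 lessThan_iff)
qed

text \<open>Fubini in the order context rows, query, \<open>beta\<close>: after each stage the
  integrand is a polynomial in the remaining Gaussian vectors whose moments are known.\<close>

lemma pgd_sq_err_integral:
  fixes A S W :: "real^'d^'d"
  assumes A: "pos_def_mat A" and S: "pos_def_mat S"
  shows "(\<integral>p. pgd_sq_err n W mu p \<partial>(task_dist n A mu S))
    = real n * (real n + 1) * trace (A ** transpose W ** A ** W ** A ** S)
      + real n * trace (W ** A ** transpose W ** A) * trace (A ** S)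
      - 2 * real n * trace (A ** W ** A ** S) + trace (A ** S)"
proof -
  define N where "N = mvn 0 A"
  define B where "B = mvn mu S"
  interpret N: prob_space N unfolding N_def by (rule prob_space_mvn[OF A])
  interpret B: prob_space B unfolding B_def by (rule prob_space_mvn[OF S])
  interpret P: prob_space "\<Pi>\<^sub>M i\<in>{..n}. N" by (rule prob_space_PiM) unfold_locales
  interpret BP: pair_prob_space B "\<Pi>\<^sub>M i\<in>{..n}. N" ..
  have [simp]: "sets N = sets borel" "space N = UNIV" by (simp_all add: N_def)
  have AT: "transpose A = A" using A by (simp add: pos_def_mat_def)
  define F where "F c xs = ((\<Sum>i<n. ((transpose W *v xs n) \<bullet> xs i) * (c \<bullet> xs i)) - xs n \<bullet> c)\<^sup>2"
    for c :: "real^'d" and xs :: "nat \<Rightarrow> real^'d"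
  have err: "pgd_sq_err n W mu (b, xs) = F (b - mu) xs" for b xs
  proof -
    have "xs n \<bullet> (W *v (\<Sum>i<n. ((xs i \<bullet> b) - (xs i \<bullet> mu)) *\<^sub>R xs i))
       = (\<Sum>i<n. ((transpose W *v xs n) \<bullet> xs i) * ((b - mu) \<bullet> xs i))"
      unfolding inner_matrix_vector inner_sum_right inner_scaleR_right inner_diff_left inner_diff_right
      by (intro sum.cong) (simp_all only: inner_commute[of b] inner_commute[of mu] mult.commute)
    then show ?thesis
      by (simp add: pgd_sq_err_def F_def Let_def inner_diff_right[of "xs n"] diff_diff_eq2 del: transpose_matrix_vector)
  qed
  have mN: "all_moments N (\<lambda>x. u \<bullet> x)" for u
    using all_moments_mvn[OF A, of 0 u] by (simp add: N_def)
  have mP: "all_moments (\<Pi>\<^sub>M i\<in>{..n}. N) (\<lambda>xs. u \<bullet> xs i)" if "i \<le> n" for u i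
    by (rule all_moments_PiM_component[OF N.prob_space_axioms _ mN]) (use that in simp)
  have mPF: "all_moments (\<Pi>\<^sub>M i\<in>{..n}. N) (F c)" for c
    unfolding F_def by (rule P.all_moments_residual) (auto intro: mP P.all_moments_const)
  have mX: "all_moments (B \<Otimes>\<^sub>M (\<Pi>\<^sub>M i\<in>{..n}. N)) (\<lambda>p. u \<bullet> snd p i)" if "i \<le> n" for u i
    by (rule all_moments_distr[of snd _ "\<Pi>\<^sub>M i\<in>{..n}. N" "\<lambda>xs. u \<bullet> xs i"])
       (use mP[OF that] in \<open>simp_all add: distr_pair_snd B.prob_space_axioms P.sigma_finite_measure_axioms\<close>)
  have mB: "all_moments B (\<lambda>b. u \<bullet> (b - mu))" for u
    unfolding B_def by (rule all_moments_mvn[OF S])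
  have mC: "all_moments (B \<Otimes>\<^sub>M (\<Pi>\<^sub>M i\<in>{..n}. N)) (\<lambda>p. u \<bullet> (fst p - mu))" for u
    by (rule all_moments_distr[of fst _ B "\<lambda>b. u \<bullet> (b - mu)"])
       (use mB in \<open>simp_all add: distr_pair_fst P.prob_space_axioms B.sigma_finite_measure_axioms\<close>)
  have mBF: "all_moments (B \<Otimes>\<^sub>M (\<Pi>\<^sub>M i\<in>{..n}. N)) (\<lambda>p. F (fst p - mu) (snd p))"
    unfolding F_def by (rule BP.all_moments_residual) (auto intro: mX mC)

  text \<open>Given \<open>c = b - mu\<close> and the query \<open>z\<close>, the error is \<open>(\<Sum>i<n. g (x i)) - s\<close> squared, with \<open>g\<close> a product of two
    linear forms, so only moments of order at most four of one row enter.\<close>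
  have inner_exp: "(\<integral>xs. F c xs \<partial>(\<Pi>\<^sub>M i\<in>{..n}. N)) = real n * (real n + 1) * ((W *v (A *v c)) \<bullet> (A *v (W *v (A *v c))))
      + real n * trace (W ** A ** transpose W ** A) * (c \<bullet> (A *v c))
      - 2 * real n * ((W *v (A *v c)) \<bullet> (A *v c)) + c \<bullet> (A *v c)" for c
  proof -
    \<comment> \<open>For \<open>w = transpose W *v z\<close> the covariance
      \<open>w \<bullet> (A *v c)\<close> is linear in the query \<open>z\<close>, with coefficient
      vector \<open>p\<close>.\<close>
    define p where "p = W *v (A *v c)"
    define h where "h z = real n * (real n + 1) * (p \<bullet> z)\<^sup>2
      + real n * (c \<bullet> (A *v c)) * (z \<bullet> ((W ** A ** transpose W) *v z)) - 2 * real n * ((p \<bullet> z) * (c \<bullet> z)) + (c \<bullet> z)\<^sup>2" for z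
    have "(\<integral>xs. F c (xs(n := z)) \<partial>(\<Pi>\<^sub>M i\<in>{..<n}. N)) = h z" for z
    proof -
      define w where "w = transpose W *v z"
      have wAc: "w \<bullet> (A *v c) = p \<bullet> z"
        unfolding w_def p_def by (metis inner_matrix_vector inner_commute)
      have wAw: "w \<bullet> (A *v w) = z \<bullet> ((W ** A ** transpose W) *v z)"
        unfolding w_def by (simp only: matrix_vector_mul_assoc[symmetric] inner_matrix_vector[of z])
      have "(\<integral>xs. F c (xs(n := z)) \<partial>(\<Pi>\<^sub>M i\<in>{..<n}. N))
         = (\<integral>xs. ((\<Sum>i<n. (w \<bullet> xs i) * (c \<bullet> xs i)) - z \<bullet> c)\<^sup>2 \<partial>(\<Pi>\<^sub>M i\<in>{..<n}. N))"
        by (simp add: F_def w_def del: transpose_matrix_vector)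
      also have "\<dots> = real n * (\<integral>x. ((w \<bullet> x) * (c \<bullet> x))\<^sup>2 \<partial>N) + real n * (real n - 1) * (\<integral>x. (w \<bullet> x) * (c \<bullet> x) \<partial>N)\<^sup>2
         - 2 * real n * (z \<bullet> c) * (\<integral>x. (w \<bullet> x) * (c \<bullet> x) \<partial>N) + (z \<bullet> c)\<^sup>2"
        using integral_iid_sum_square[OF N.prob_space_axioms all_moments_mult[OF mN mN], of "{..<n}"] by simp
      also have "(\<integral>x. ((w \<bullet> x) * (c \<bullet> x))\<^sup>2 \<partial>N) = (w \<bullet> (A *v w)) * (c \<bullet> (A *v c)) + 2 * (w \<bullet> (A *v c))\<^sup>2"
        using mvn_fourth_moment[OF A, of 0 w c] by (simp add: N_def)
      also have "(\<integral>x. (w \<bullet> x) * (c \<bullet> x) \<partial>N) = w \<bullet> (A *v c)"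
        using mvn_covariance[OF A, of 0 w c] by (simp add: N_def)
      also have "real n * ((w \<bullet> (A *v w)) * (c \<bullet> (A *v c)) + 2 * (w \<bullet> (A *v c))\<^sup>2) + real n * (real n - 1) * (w \<bullet> (A *v c))\<^sup>2
         - 2 * real n * (z \<bullet> c) * (w \<bullet> (A *v c)) + (z \<bullet> c)\<^sup>2 = h z"
        unfolding h_def wAc wAw inner_commute[of z c] by (simp add: power2_eq_square algebra_simps)
      finally show ?thesis .
    qed
    moreover have "h \<in> borel_measurable N"
    proof -
      have "continuous_on UNIV h"
        unfolding h_def by (intro continuous_intros matrix_vector_mult_linear_continuous_on)
      then show ?thesis
        using borel_measurable_continuous_onI by (metis measurable_cong_sets \<open>sets N = sets borel\<close>)
    qed
    ultimately have "(\<integral>xs. F c xs \<partial>(\<Pi>\<^sub>M i\<in>{..n}. N)) = (\<integral>z. h z \<partial>N)"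
      by (intro integral_PiM_lessThan_Suc N.prob_space_axioms all_moments_integrable mPF)
    also have "\<dots> = real n * (real n + 1) * (p \<bullet> (A *v p)) + real n * (c \<bullet> (A *v c)) * trace (W ** A ** transpose W ** A)
        - 2 * real n * (p \<bullet> (A *v c)) + c \<bullet> (A *v c)"
    proof -
      have q: "all_moments N (\<lambda>z. z \<bullet> (R *v z))" for R
        by (rule N.all_moments_inner) (auto simp: mN inner_matrix_vector simp del: transpose_matrix_vector)
      have m: "(\<integral>z. (u \<bullet> z)\<^sup>2 \<partial>N) = u \<bullet> (A *v u)" "(\<integral>z. (u \<bullet> z) * (v \<bullet> z) \<partial>N) = u \<bullet> (A *v v)"
        "(\<integral>z. z \<bullet> (R *v z) \<partial>N) = trace (R ** A)" for u v R
        using mvn_moment2[OF A, of 0 u] mvn_covariance[OF A, of 0 u v] mvn_quadratic_form[OF A, of 0 R]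
        by (simp_all add: N_def)
      show ?thesis
        unfolding h_def
        by (simp add: m all_moments_integrable N.all_moments_power all_moments_mult mN q del: transpose_matrix_vector)
    qed
    finally show ?thesis by (simp add: p_def algebra_simps)
  qed

  have "(\<integral>p. pgd_sq_err n W mu p \<partial>(task_dist n A mu S))
     = (\<integral>p. F (fst p - mu) (snd p) \<partial>(B \<Otimes>\<^sub>M (\<Pi>\<^sub>M i\<in>{..n}. N)))"
    unfolding task_dist_def N_def[symmetric] B_def[symmetric]
    by (intro Bochner_Integration.integral_cong) (auto simp: err)
  also have "\<dots> = (\<integral>b. (\<integral>xs. F (b - mu) xs \<partial>(\<Pi>\<^sub>M i\<in>{..n}. N)) \<partial>B)"
    using BP.integral_fst'[OF all_moments_integrable[OF mBF]] by simp
  also have "\<dots> = (\<integral>b. real n * (real n + 1) * ((b - mu) \<bullet> ((A ** transpose W ** A ** W ** A) *v (b - mu)))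
      + real n * trace (W ** A ** transpose W ** A) * ((b - mu) \<bullet> (A *v (b - mu)))
      - 2 * real n * ((b - mu) \<bullet> ((A ** W ** A) *v (b - mu))) + (b - mu) \<bullet> (A *v (b - mu)) \<partial>B)"
  proof -
    \<comment> \<open>Each scalar takes the form \<open>c \<bullet> (R *v c)\<close>, so that
      \<open>mvn_quadratic_form\<close> turns the expectation over \<open>beta\<close> into a
      trace.\<close>
    have "(W *v (A *v c)) \<bullet> (A *v (W *v (A *v c))) = c \<bullet> ((A ** transpose W ** A ** W ** A) *v c)" for c
      by (simp only: matrix_vector_mul_assoc[symmetric] inner_matrix_vector[of c] AT inner_matrix_vector[of "A *v c"] transpose_transpose)
    moreover have "(W *v (A *v c)) \<bullet> (A *v c) = c \<bullet> ((A ** W ** A) *v c)" for c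
      by (simp only: matrix_vector_mul_assoc[symmetric] inner_matrix_vector[of c] AT inner_commute)
    ultimately show ?thesis by (simp only: inner_exp)
  qed
  also have "\<dots> = real n * (real n + 1) * trace (A ** transpose W ** A ** W ** A ** S)
      + real n * trace (W ** A ** transpose W ** A) * trace (A ** S)
      - 2 * real n * trace (A ** W ** A ** S) + trace (A ** S)"
  proof -
    have "all_moments B (\<lambda>b. (b - mu) \<bullet> (R *v (b - mu)))" for R
      by (rule B.all_moments_inner) (auto simp: mB inner_matrix_vector simp del: transpose_matrix_vector)
    moreover have "(\<integral>b. (b - mu) \<bullet> (R *v (b - mu)) \<partial>B) = trace (R ** S)" for R
      unfolding B_def by (rule mvn_quadratic_form[OF S])
    ultimately show ?thesis
      by (simp add: all_moments_integrable del: transpose_matrix_vector)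
  qed
  finally show ?thesis .
qed


text \<open>Every term is linear in \<open>trace (X ** Sb k)\<close> for some \<open>X\<close>
  independent of \<open>k\<close>, so the weighted sum replaces \<open>Sb k\<close> by
  \<open>B\<close>. Cyclic rotation then gives both terms quadratic in \<open>W\<close> the same
  left factor, and their right factors add up to \<open>M\<close>.\<close>

lemma pgd_loss_eq:
  fixes Sx :: "real^'d^'d" and n K :: nat and pik :: "nat \<Rightarrow> real"
  assumes Sx: "pos_def_mat Sx" and Sb: "\<And>k. k < K \<Longrightarrow> pos_def_mat (Sb k)"
  defines "B \<equiv> \<Sum>k<K. pik k *\<^sub>R Sb k"
  defines "t \<equiv> trace (Sx ** B)"
  defines "M \<equiv> real (n + 1) *\<^sub>R (Sx ** B ** Sx) + t *\<^sub>R Sx"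
  shows "pgd_loss n K Sx pik mu Sb W
    = real n * trace (transpose W ** Sx ** W ** M) - 2 * real n * trace (Sx ** W ** Sx ** B) + t"
proof -
  have lin: "(\<Sum>k<K. pik k * trace (X ** Sb k)) = trace (X ** B)" for X
    by (simp add: B_def matrix_mul_sum_right matrix_mul_scaleR_right trace_sum trace_scaleR)
  have "pgd_loss n K Sx pik mu Sb W = (\<Sum>k<K. pik k *
     (real n * (real n + 1) * trace (Sx ** transpose W ** Sx ** W ** Sx ** Sb k)
      + real n * trace (W ** Sx ** transpose W ** Sx) * trace (Sx ** Sb k)
      - 2 * real n * trace (Sx ** W ** Sx ** Sb k) + trace (Sx ** Sb k)))"
    unfolding pgd_loss_def by (intro sum.cong) (simp_all add: pgd_sq_err_integral Sx Sb)
  also have "\<dots> = real n * (real n + 1) * (\<Sum>k<K. pik k * trace ((Sx ** transpose W ** Sx ** W ** Sx) ** Sb k))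
      + real n * trace (W ** Sx ** transpose W ** Sx) * (\<Sum>k<K. pik k * trace (Sx ** Sb k))
      - 2 * real n * (\<Sum>k<K. pik k * trace ((Sx ** W ** Sx) ** Sb k)) + (\<Sum>k<K. pik k * trace (Sx ** Sb k))"
    unfolding sum_distrib_left sum.distrib[symmetric] sum_subtractf[symmetric]
    by (intro sum.cong) (simp_all add: algebra_simps)
  also have "\<dots> = real n * (real n + 1) * trace (Sx ** transpose W ** Sx ** W ** Sx ** B)
      + real n * trace (W ** Sx ** transpose W ** Sx) * t - 2 * real n * trace (Sx ** W ** Sx ** B) + t"
    unfolding lin t_def ..
  also have "trace (Sx ** transpose W ** Sx ** W ** Sx ** B) = trace (transpose W ** Sx ** W ** (Sx ** B ** Sx))"
    using trace_mul_sym[of Sx "transpose W ** Sx ** W ** Sx ** B"] by (simp add: matrix_mul_assoc)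
  also have "trace (W ** Sx ** transpose W ** Sx) = trace (transpose W ** Sx ** W ** Sx)"
    using trace_mul_sym[of "W ** Sx" "transpose W ** Sx"] by (simp add: matrix_mul_assoc)
  finally show ?thesis
    by (simp add: M_def matrix_add_ldistrib matrix_mul_scaleR_right trace_add trace_scaleR algebra_simps)
qed

section \<open>Completing the square\<close>

theorem theorem4:
  fixes n K :: nat
    and Sx :: "real^'d^'d"
    and mu :: "nat \<Rightarrow> real^'d"
    and Sb :: "nat \<Rightarrow> real^'d^'d"
    and pik :: "nat \<Rightarrow> real"
    and Wstar :: "real^'d^'d"
  assumes "n \<ge> 1" and "K \<ge> 1"
    and "pos_def_mat Sx"
    and "\<And>k. k < K \<Longrightarrow> pos_def_mat (Sb k)"
    and "\<And>k. k < K \<Longrightarrow> pik k \<ge> 0"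
    and "(\<Sum>k<K. pik k) = 1"
    and "\<And>W. pgd_loss n K Sx pik mu Sb Wstar \<le> pgd_loss n K Sx pik mu Sb W"
  shows "let SbarB = Sx ** (\<Sum>k<K. pik k *\<^sub>R Sb k);
             WbarStar = Sx ** Wstar
         in WbarStar = SbarB ** matrix_inv (real (n + 1) *\<^sub>R SbarB + trace SbarB *\<^sub>R mat 1)
          \<and> pgd_loss n K Sx pik mu Sb Wstar = trace SbarB - real n * trace (WbarStar ** SbarB)"
proof -
  note Sx = assms(3)
  define B where "B = (\<Sum>k<K. pik k *\<^sub>R Sb k)"
  define t where "t = trace (Sx ** B)"
  define M where "M = real (n + 1) *\<^sub>R (Sx ** B ** Sx) + t *\<^sub>R Sx"
  define L where "L = pgd_loss n K Sx pik mu Sb"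
  have L: "L W = real n * trace (transpose W ** Sx ** W ** M) - 2 * real n * trace (Sx ** W ** Sx ** B) + t" for W
    unfolding L_def M_def t_def B_def by (rule pgd_loss_eq) (use assms in auto)
  have B: "pos_def_mat B"
    unfolding B_def by (rule pos_def_convex_sum) (use assms in auto)
  have tr[simp]: "transpose Sx = Sx" "transpose B = B"
    using Sx B by (simp_all add: pos_def_mat_def)
  \<comment> \<open>With \<open>H = mat 1\<close>, \<open>trace_pos_def_pos\<close> gives a positive
    trace even though \<open>Sx ** B\<close> need not be symmetric.\<close>
  have "mat 1 \<noteq> (0 :: real^'d^'d)" by (simp add: mat_def vec_eq_iff)
  then have t: "t > 0"
    using trace_pos_def_pos[OF Sx B, of "mat 1"] by (simp add: t_def)
  have Mtr[simp]: "transpose M = M"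
    by (simp add: M_def transpose_add transpose_scalar matrix_transpose_mul matrix_mul_assoc)
  have M: "pos_def_mat M"
    unfolding pos_def_mat_def
  proof (intro conjI allI impI)
    fix v :: "real^'d" assume v: "v \<noteq> 0"
    have "v \<bullet> (M *v v) = real (n + 1) * ((Sx *v v) \<bullet> (B *v (Sx *v v))) + t * (v \<bullet> (Sx *v v))"
      by (simp add: M_def matrix_vector_mult_add_rdistrib inner_add_right inner_matrix_vector[of v Sx] flip: scaleR_matrix_vector_assoc matrix_vector_mul_assoc
           del: transpose_matrix_vector of_nat_add)
    \<comment> \<open>Nonnegativity is enough here; the summand with \<open>t\<close> supplies
      strictness.\<close>
    moreover have "(Sx *v v) \<bullet> (B *v (Sx *v v)) \<ge> 0"
      using B by (cases "Sx *v v = 0") (auto simp: pos_def_mat_def intro: less_imp_le)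
    moreover have "t * (v \<bullet> (Sx *v v)) > 0"
      using Sx v t by (simp add: pos_def_mat_def)
    ultimately show "v \<bullet> (M *v v) > 0"
      by (simp add: add_nonneg_pos)
  qed simp
  obtain T where T: "M ** T = mat 1" by (rule pos_def_invertible[OF M])
  have T': "T ** M = mat 1" using T matrix_left_right_inverse by blast
  \<comment> \<open>Setting the gradient to zero gives \<open>Sx ** W ** M = Sx ** B ** Sx\<close>;
    cancelling \<open>Sx\<close> leaves \<open>W ** M = B ** Sx\<close>.\<close>
  define W0 where "W0 = B ** Sx ** T"
  have W0: "W0 ** M = B ** Sx" by (simp add: W0_def T' flip: matrix_mul_assoc)
  \<comment> \<open>Both mixed terms of the quadratic form equal the linear term; they agree with
    each other by transposition, as \<open>Sx\<close> and \<open>M\<close> are symmetric.\<close>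
  have cross: "trace (transpose H ** Sx ** W0 ** M) = trace (Sx ** H ** Sx ** B)"
      "trace (transpose W0 ** Sx ** H ** M) = trace (Sx ** H ** Sx ** B)" for H
  proof -
    have "trace (transpose H ** Sx ** W0 ** M) = trace (transpose H ** Sx ** B ** Sx)"
      by (simp add: W0 flip: matrix_mul_assoc)
    also have "\<dots> = trace (transpose (transpose H ** Sx ** B ** Sx))"
      by (rule trace_transpose[symmetric])
    also have "\<dots> = trace (Sx ** B ** (Sx ** H))"
      by (simp add: matrix_transpose_mul matrix_mul_assoc)
    also have "\<dots> = trace (Sx ** H ** Sx ** B)"
      by (subst trace_mul_sym) (simp add: matrix_mul_assoc)
    finally show 1: "trace (transpose H ** Sx ** W0 ** M) = trace (Sx ** H ** Sx ** B)" .
    have "trace (transpose W0 ** Sx ** H ** M) = trace (transpose (transpose W0 ** Sx ** H ** M))"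
      by (rule trace_transpose[symmetric])
    also have "\<dots> = trace (M ** (transpose H ** Sx ** W0))"
      by (simp add: matrix_transpose_mul matrix_mul_assoc)
    also have "\<dots> = trace (transpose H ** Sx ** W0 ** M)"
      by (rule trace_mul_sym)
    finally show "trace (transpose W0 ** Sx ** H ** M) = trace (Sx ** H ** Sx ** B)"
      using 1 by simp
  qed
  text \<open>\<open>W0\<close> annihilates the linear term, so the loss exceeds its value there by a positive definite form.\<close>
  have square: "L (W0 + H) = L W0 + real n * trace (transpose H ** Sx ** H ** M)" for H
  proof -
    have "trace (transpose (W0 + H) ** Sx ** (W0 + H) ** M)
       = trace (transpose W0 ** Sx ** W0 ** M) + 2 * trace (Sx ** H ** Sx ** B) + trace (transpose H ** Sx ** H ** M)"
      by (simp add: transpose_add matrix_add_ldistrib matrix_add_rdistrib trace_add cross)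
    then show ?thesis
      by (simp add: L matrix_add_ldistrib matrix_add_rdistrib trace_add algebra_simps)
  qed
  \<comment> \<open>Since \<open>n \<ge> 1\<close>, the excess over the value at \<open>W0\<close>
    is strictly positive for any other matrix.\<close>
  have "Wstar = W0"
  proof (rule ccontr)
    assume "Wstar \<noteq> W0"
    then have "trace (transpose (Wstar - W0) ** Sx ** (Wstar - W0) ** M) > 0"
      by (intro trace_pos_def_pos Sx M) simp
    then have "L Wstar > L W0"
      using square[of "Wstar - W0"] assms(1) by simp
    then show False using assms(7)[of W0] by (simp add: L_def)
  qed
  moreover have "matrix_inv (real (n + 1) *\<^sub>R (Sx ** B) + t *\<^sub>R mat 1) = Sx ** T"
  proof (rule matrix_inv_eqI)
    have "(real (n + 1) *\<^sub>R (Sx ** B) + t *\<^sub>R mat 1) ** Sx = M"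
      by (simp add: M_def matrix_add_rdistrib matrix_mul_scaleR_left)
    then show "(real (n + 1) *\<^sub>R (Sx ** B) + t *\<^sub>R mat 1) ** (Sx ** T) = mat 1"
      by (simp only: matrix_mul_assoc T)
  qed
  \<comment> \<open>By \<open>cross\<close> with \<open>H = W0\<close>, the quadratic term is n
    times the same trace that the linear term subtracts 2n times.\<close>
  moreover have "L W0 = t - real n * trace (Sx ** W0 ** (Sx ** B))"
    unfolding L cross by (simp add: matrix_mul_assoc)
  ultimately show ?thesis
    by (simp add: Let_def W0_def matrix_mul_assoc flip: B_def t_def L_def)
qed

end
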